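(* Let $\mathscr{C}$ be a dg category over a field $\Bbbk$ of characteristic $0$, let $\mathscr{C}_1,\dots,\mathscr{C}_k$ be full essentially small dg subcategories of $\mathscr{C}$, let $\mathscr{C}/(\mathscr{C}_1,\dots,\mathscr{C}_k)$ be the refined Drinfeld dg quotient (formed using chosen small representatives $\overline{\mathscr{C}}_i$), and let $\mathscr{C}_\Sigma$ be the full dg subcategory of $\mathscr{C}$ with $\mathrm{Ob}\,\mathscr{C}_\Sigma=\bigcup_{i=1}^k\mathrm{Ob}\,\overline{\mathscr{C}}_i$. Then the natural dg functor $$\Psi\colon\mathscr{C}/(\mathscr{C}_1,\dots,\mathscr{C}_k)\to\mathscr{C}/\mathscr{C}_\Sigma$$ which is the identity on $\mathscr{C}$, sends every $\varepsilon_X^i$ to $\varepsilon_X$ and sends every $\varepsilon_X^{i_1\dots i_s}$ with $s>1$ to $0$, is a quasi-equivalence of dg categories.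
   Context: **Representatives.** Each $\mathscr{C}_i$ is replaced by a small full subcategory $\overline{\mathscr{C}}_i\subset\mathscr{C}_i$ obtained by taking one object in each isomorphism class, the choices being made compatibly so that $\overline{\mathscr{C}}_{i_1}\cap\dots\cap\overline{\mathscr{C}}_{i_\ell}$ is equivalent to $\mathscr{C}_{i_1}\cap\dots\cap\mathscr{C}_{i_\ell}$ for all intersections. **Refined Drinfeld dg quotient $\mathscr{C}/(\mathscr{C}_1,\dots,\mathscr{C}_k)$.** It has the same objects as $\mathscr{C}$; its morphisms are freely generated by the morphisms of $\mathscr{C}$ (with their composition) together with, for each $s\ge1$, each $1\le i_1<\dots<i_s\le k$ and each object $X\in\overline{\mathscr{C}}_{i_1}\cap\dots\cap\overline{\mathscr{C}}_{i_s}$, a new morphism $\varepsilon_X^{i_1\dots i_s}\colon X\to X$ of degree $-s$, with differential (Čech sign rule) $d\varepsilon_X^{i_1\dots i_s}=\sum_{t=1}^s(-1)^{s-t}\varepsilon_X^{i_1\dots\widehat{i_t}\dots i_s}$, where $\varepsilon_X^{\emptyset}=\mathrm{id}_X$ (so $d\varepsilon^i_X=\mathrm{id}_X$, $d\varepsilon^{ij}_X=\varepsilon^i_X-\varepsilon^j_X$, $d\varepsilon^{ijk}_X=\varepsilon^{ij}_X-\varepsilon^{ik}_X+\varepsilon^{jk}_X$, etc.), extended by the Leibniz rule. **Drinfeld dg quotient $\mathscr{C}/\mathscr{C}_\Sigma$.** It has the same objects as $\mathscr{C}$; its morphisms are freely generated by the morphisms of $\mathscr{C}$ (with their composition) and,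 for each $X\in\mathrm{Ob}\,\mathscr{C}_\Sigma$, a new morphism $\varepsilon_X\colon X\to X$ of degree $-1$ with $d\varepsilon_X=\mathrm{id}_X$. *)

theory Defs
  imports
    "HOL-Algebra.Algebraic_Closure_Type"
    "HOL-Library.Poly_Mapping"
begin

(* this notation would turn the identifier X into a keyword of the term language *)
no_notation var (\<open>X\<index>\<close>)

section \<open>Dg categories\<close>

text \<open>
  The ground field is a type \<open>'k\<close> of class \<open>field\<close>; the degree \<open>n\<close> part of a morphism complex is
  a HOL-Algebra module over \<open>'k\<close> (the fields \<open>mult\<close> and \<open>one\<close> of the module record carry no
  meaning).  Grading is cohomological, and \<open>cmp C X Y Z m n g f\<close> is the composite
  \<open>g \<circ> f\<close> of \<open>g : Y \<rightarrow> Z\<close> of degree \<open>m\<close> with \<open>f : X \<rightarrow> Y\<close> of degree \<open>n\<close>.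
\<close>

record ('o, 'm, 'k) dgcat =
  Obj :: "'o set"
  Hom :: "'o \<Rightarrow> 'o \<Rightarrow> int \<Rightarrow> ('k, 'm) module"
  dif :: "'o \<Rightarrow> 'o \<Rightarrow> int \<Rightarrow> 'm \<Rightarrow> 'm"
  cmp :: "'o \<Rightarrow> 'o \<Rightarrow> 'o \<Rightarrow> int \<Rightarrow> int \<Rightarrow> 'm \<Rightarrow> 'm \<Rightarrow> 'm"
  idt :: "'o \<Rightarrow> 'm"

definition klinear :: "('k, 'a) module \<Rightarrow> ('k, 'b) module \<Rightarrow> ('a \<Rightarrow> 'b) \<Rightarrow> bool" where
  "klinear M N f \<longleftrightarrow>
     f \<in> carrier M \<rightarrow> carrier N \<and>
     (\<forall>x\<in>carrier M. \<forall>y\<in>carrier M. f (x \<oplus>\<^bsub>M\<^esub> y) = f x \<oplus>\<^bsub>N\<^esub> f y) \<and>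
     (\<forall>c. \<forall>x\<in>carrier M. f (c \<odot>\<^bsub>M\<^esub> x) = c \<odot>\<^bsub>N\<^esub> f x)"

locale dg_category =
  fixes C :: "('o, 'm, 'k::field) dgcat"
  assumes hom_module:
      "\<lbrakk>X \<in> Obj C; Y \<in> Obj C\<rbrakk> \<Longrightarrow> module (ring_of_type_algebra :: 'k ring) (Hom C X Y n)"
    and dif_linear:
      "\<lbrakk>X \<in> Obj C; Y \<in> Obj C\<rbrakk> \<Longrightarrow> klinear (Hom C X Y n) (Hom C X Y (n + 1)) (dif C X Y n)"
    and dif_dif:
      "\<lbrakk>X \<in> Obj C; Y \<in> Obj C; f \<in> carrier (Hom C X Y n)\<rbrakk>
        \<Longrightarrow> dif C X Y (n + 1) (dif C X Y n f) = \<zero>\<^bsub>Hom C X Y (n + 1 + 1)\<^esub>"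
    and cmp_linear_left:
      "\<lbrakk>X \<in> Obj C; Y \<in> Obj C; Z \<in> Obj C; f \<in> carrier (Hom C X Y n)\<rbrakk>
        \<Longrightarrow> klinear (Hom C Y Z m) (Hom C X Z (m + n)) (\<lambda>g. cmp C X Y Z m n g f)"
    and cmp_linear_right:
      "\<lbrakk>X \<in> Obj C; Y \<in> Obj C; Z \<in> Obj C; g \<in> carrier (Hom C Y Z m)\<rbrakk>
        \<Longrightarrow> klinear (Hom C X Y n) (Hom C X Z (m + n)) (\<lambda>f. cmp C X Y Z m n g f)"
    and cmp_assoc:
      "\<lbrakk>W \<in> Obj C; X \<in> Obj C; Y \<in> Obj C; Z \<in> Obj C;
        h \<in> carrier (Hom C Y Z l); g \<in> carrier (Hom C X Y m); f \<in> carrier (Hom C W X n)\<rbrakk>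
        \<Longrightarrow> cmp C W X Z (l + m) n (cmp C X Y Z l m h g) f =
            cmp C W Y Z l (m + n) h (cmp C W X Y m n g f)"
    and idt_closed: "X \<in> Obj C \<Longrightarrow> idt C X \<in> carrier (Hom C X X 0)"
    and idt_left:
      "\<lbrakk>X \<in> Obj C; Y \<in> Obj C; f \<in> carrier (Hom C X Y n)\<rbrakk> \<Longrightarrow> cmp C X Y Y 0 n (idt C Y) f = f"
    and idt_right:
      "\<lbrakk>X \<in> Obj C; Y \<in> Obj C; f \<in> carrier (Hom C X Y n)\<rbrakk> \<Longrightarrow> cmp C X X Y n 0 f (idt C X) = f"
    and leibniz:
      "\<lbrakk>X \<in> Obj C; Y \<in> Obj C; Z \<in> Obj C;
        g \<in> carrier (Hom C Y Z m); f \<in> carrier (Hom C X Y n)\<rbrakk>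
        \<Longrightarrow> dif C X Z (m + n) (cmp C X Y Z m n g f) =
            cmp C X Y Z (m + 1) n (dif C Y Z m g) f
            \<oplus>\<^bsub>Hom C X Z (m + n + 1)\<^esub>
            ((- 1) powi m) \<odot>\<^bsub>Hom C X Z (m + n + 1)\<^esub> cmp C X Y Z m (n + 1) g (dif C X Y n f)"

text \<open>The full dg subcategory on a set \<open>S \<subseteq> Obj C\<close>.\<close>

definition full_sub :: "('o, 'm, 'k) dgcat \<Rightarrow> 'o set \<Rightarrow> ('o, 'm, 'k) dgcat" where
  "full_sub C S = C\<lparr>Obj := S\<rparr>"

definition cocycles :: "('o, 'm, 'k) dgcat \<Rightarrow> 'o \<Rightarrow> 'o \<Rightarrow> int \<Rightarrow> 'm set" where
  "cocycles C X Y n = {f \<in> carrier (Hom C X Y n). dif C X Y n f = \<zero>\<^bsub>Hom C X Y (n + 1)\<^esub>}"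

definition coboundaries :: "('o, 'm, 'k) dgcat \<Rightarrow> 'o \<Rightarrow> 'o \<Rightarrow> int \<Rightarrow> 'm set" where
  "coboundaries C X Y n = dif C X Y (n - 1) ` carrier (Hom C X Y (n - 1))"

definition cohomology :: "('o, 'm, 'k) dgcat \<Rightarrow> 'o \<Rightarrow> 'o \<Rightarrow> int \<Rightarrow> 'm set monoid" where
  "cohomology C X Y n =
     ((Hom C X Y n)\<lparr>carrier := cocycles C X Y n\<rparr>) A_Mod (coboundaries C X Y n)"

definition coh_class :: "('o, 'm, 'k) dgcat \<Rightarrow> 'o \<Rightarrow> 'o \<Rightarrow> int \<Rightarrow> 'm \<Rightarrow> 'm set" where
  "coh_class C X Y n f = coboundaries C X Y n +>\<^bsub>Hom C X Y n\<^esub> f"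

definition dg_isomorphic :: "('o, 'm, 'k) dgcat \<Rightarrow> 'o \<Rightarrow> 'o \<Rightarrow> bool" where
  "dg_isomorphic C X Y \<longleftrightarrow>
     (\<exists>f\<in>cocycles C X Y 0. \<exists>g\<in>cocycles C Y X 0.
        cmp C X Y X 0 0 g f = idt C X \<and> cmp C Y X Y 0 0 f g = idt C Y)"

text \<open>Isomorphism in the homotopy category \<open>H\<^sup>0(C)\<close>.\<close>

definition H0_isomorphic :: "('o, 'm, 'k) dgcat \<Rightarrow> 'o \<Rightarrow> 'o \<Rightarrow> bool" where
  "H0_isomorphic C X Y \<longleftrightarrow>
     (\<exists>f\<in>cocycles C X Y 0. \<exists>g\<in>cocycles C Y X 0.
        coh_class C X X 0 (cmp C X Y X 0 0 g f) = coh_class C X X 0 (idt C X) \<and>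
        coh_class C Y Y 0 (cmp C Y X Y 0 0 f g) = coh_class C Y Y 0 (idt C Y))"


section \<open>Dg functors and quasi-equivalences\<close>

record ('o, 'm, 'p, 'n) dgfun =
  fobj :: "'o \<Rightarrow> 'p"
  fmor :: "'o \<Rightarrow> 'o \<Rightarrow> int \<Rightarrow> 'm \<Rightarrow> 'n"

locale dg_functor = A: dg_category A + B: dg_category B
  for A :: "('o, 'm, 'k::field) dgcat" and B :: "('p, 'n, 'k) dgcat"
    and F :: "('o, 'm, 'p, 'n) dgfun" +
  assumes fobj_closed: "X \<in> Obj A \<Longrightarrow> fobj F X \<in> Obj B"
    and fmor_linear:
      "\<lbrakk>X \<in> Obj A; Y \<in> Obj A\<rbrakk>
        \<Longrightarrow> klinear (Hom A X Y n) (Hom B (fobj F X) (fobj F Y) n) (fmor F X Y n)"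
    and fmor_dif:
      "\<lbrakk>X \<in> Obj A; Y \<in> Obj A; f \<in> carrier (Hom A X Y n)\<rbrakk>
        \<Longrightarrow> fmor F X Y (n + 1) (dif A X Y n f) = dif B (fobj F X) (fobj F Y) n (fmor F X Y n f)"
    and fmor_cmp:
      "\<lbrakk>X \<in> Obj A; Y \<in> Obj A; Z \<in> Obj A;
        g \<in> carrier (Hom A Y Z m); f \<in> carrier (Hom A X Y n)\<rbrakk>
        \<Longrightarrow> fmor F X Z (m + n) (cmp A X Y Z m n g f) =
            cmp B (fobj F X) (fobj F Y) (fobj F Z) m n (fmor F Y Z m g) (fmor F X Y n f)"
    and fmor_idt: "X \<in> Obj A \<Longrightarrow> fmor F X X 0 (idt A X) = idt B (fobj F X)"

definition coh_map ::
  "('p, 'n, 'k) dgcat \<Rightarrow> ('o, 'm, 'p, 'n) dgfun \<Rightarrow> 'o \<Rightarrow> 'o \<Rightarrow> int \<Rightarrow> 'm set \<Rightarrow> 'n set" where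
  "coh_map B F X Y n K = (\<Union>f\<in>K. coh_class B (fobj F X) (fobj F Y) n (fmor F X Y n f))"

text \<open>
  Cohomology is recorded as an additive group; \<open>coh_map\<close> is induced by a \<open>'k\<close>-linear map, so a group
  isomorphism here is an isomorphism of \<open>'k\<close>-modules.
\<close>

definition quasi_equivalence ::
  "('o, 'm, 'k::field) dgcat \<Rightarrow> ('p, 'n, 'k) dgcat \<Rightarrow> ('o, 'm, 'p, 'n) dgfun \<Rightarrow> bool" where
  "quasi_equivalence A B F \<longleftrightarrow>
     dg_functor A B F \<and>
     (\<forall>X\<in>Obj A. \<forall>Y\<in>Obj A. \<forall>n.
        coh_map B F X Y n \<in> iso (cohomology A X Y n) (cohomology B (fobj F X) (fobj F Y) n)) \<and>
     (\<forall>Y\<in>Obj B. \<exists>X\<in>Obj A. H0_isomorphic B (fobj F X) Y)"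

definition dg_equivalence ::
  "('o, 'm, 'k::field) dgcat \<Rightarrow> ('p, 'n, 'k) dgcat \<Rightarrow> ('o, 'm, 'p, 'n) dgfun \<Rightarrow> bool" where
  "dg_equivalence A B F \<longleftrightarrow>
     dg_functor A B F \<and>
     (\<forall>X\<in>Obj A. \<forall>Y\<in>Obj A. \<forall>n.
        bij_betw (fmor F X Y n)
          (carrier (Hom A X Y n)) (carrier (Hom B (fobj F X) (fobj F Y) n))) \<and>
     (\<forall>Y\<in>Obj B. \<exists>X\<in>Obj A. dg_isomorphic B (fobj F X) Y)"

definition inclusion_functor :: "('o, 'm, 'o, 'm) dgfun" where
  "inclusion_functor = \<lparr>fobj = (\<lambda>X. X), fmor = (\<lambda>X Y n f. f)\<rparr>"


section \<open>Freely adjoining endomorphisms to a dg category\<close>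

text \<open>
  Words are formal composites, written in the order of composition: the last letter of the list
  is applied first.  A letter is either a homogeneous morphism of \<open>C\<close>, tagged with source,
  target and degree, or a new generator \<open>Eps X e : X \<rightarrow> X\<close>.  Morphisms are formal
  \<open>'k\<close>-linear combinations of words.
\<close>

datatype ('o, 'm, 'e) letter = Mor 'o 'o int 'm | Eps 'o 'e

type_synonym ('o, 'm, 'e) word = "('o, 'm, 'e) letter list"
type_synonym ('o, 'm, 'e, 'k) lincomb = "('o, 'm, 'e) word \<Rightarrow>\<^sub>0 'k"

text \<open>\<open>gens G X\<close> is the set of generators at \<open>X\<close>; \<open>gdif G X e\<close> is the prescribed differential
  of \<open>Eps X e\<close>.\<close>

record (overloaded) ('o, 'm, 'e, 'k) generators =
  gens :: "'o \<Rightarrow> 'e set"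
  gdeg :: "'e \<Rightarrow> int"
  gdif :: "'o \<Rightarrow> 'e \<Rightarrow> ('o, 'm, 'e, 'k) lincomb"

definition scal :: "'k::field \<Rightarrow> ('w \<Rightarrow>\<^sub>0 'k) \<Rightarrow> ('w \<Rightarrow>\<^sub>0 'k)" where
  "scal c p = Poly_Mapping.map ((*) c) p"

definition lin_extend :: "('v \<Rightarrow> 'w \<Rightarrow>\<^sub>0 'k::field) \<Rightarrow> ('v \<Rightarrow>\<^sub>0 'k) \<Rightarrow> ('w \<Rightarrow>\<^sub>0 'k)" where
  "lin_extend f p = (\<Sum>w\<in>Poly_Mapping.keys p. scal (Poly_Mapping.lookup p w) (f w))"

abbreviation wd :: "'l list \<Rightarrow> 'l list \<Rightarrow>\<^sub>0 'k::field" where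
  "wd w \<equiv> Poly_Mapping.single w 1"

definition wmul :: "('l list \<Rightarrow>\<^sub>0 'k::field) \<Rightarrow> ('l list \<Rightarrow>\<^sub>0 'k) \<Rightarrow> ('l list \<Rightarrow>\<^sub>0 'k)" where
  "wmul p q = lin_extend (\<lambda>u. lin_extend (\<lambda>v. wd (u @ v)) q) p"

context
  fixes C :: "('o, 'm, 'k::field) dgcat" and G :: "('o, 'm, 'e, 'k) generators"
begin

fun is_word :: "'o \<Rightarrow> 'o \<Rightarrow> ('o, 'm, 'e) word \<Rightarrow> bool" where
  "is_word X Y [] \<longleftrightarrow> X = Y \<and> X \<in> Obj C"
| "is_word X Y (Mor A B n f # w) \<longleftrightarrow>
     A \<in> Obj C \<and> B \<in> Obj C \<and> f \<in> carrier (Hom C A B n) \<and> B = Y \<and> is_word X A w"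
| "is_word X Y (Eps A e # w) \<longleftrightarrow> A \<in> Obj C \<and> e \<in> gens G A \<and> A = Y \<and> is_word X A w"

fun letter_deg :: "('o, 'm, 'e) letter \<Rightarrow> int" where
  "letter_deg (Mor A B n f) = n"
| "letter_deg (Eps A e) = gdeg G e"

definition word_deg :: "('o, 'm, 'e) word \<Rightarrow> int" where
  "word_deg w = sum_list (map letter_deg w)"

definition free_hom :: "'o \<Rightarrow> 'o \<Rightarrow> int \<Rightarrow> ('o, 'm, 'e, 'k) lincomb set" where
  "free_hom X Y n = {p. \<forall>w\<in>Poly_Mapping.keys p. is_word X Y w \<and> word_deg w = n}"

fun letter_dif :: "('o, 'm, 'e) letter \<Rightarrow> ('o, 'm, 'e, 'k) lincomb" where
  "letter_dif (Mor A B n f) = wd [Mor A B (n + 1) (dif C A B n f)]"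
| "letter_dif (Eps A e) = gdif G A e"

fun word_dif :: "('o, 'm, 'e) word \<Rightarrow> ('o, 'm, 'e, 'k) lincomb" where
  "word_dif [] = 0"
| "word_dif (l # w) =
     wmul (letter_dif l) (wd w) + scal ((- 1) powi letter_deg l) (wmul (wd [l]) (word_dif w))"

text \<open>
  The two-sided homogeneous ideal of relations: a morphism of \<open>C\<close>, viewed as a letter, depends
  linearly on the morphism, and formal composites and identities of morphisms of \<open>C\<close> are the
  actual ones.
\<close>

inductive null :: "'o \<Rightarrow> 'o \<Rightarrow> int \<Rightarrow> ('o, 'm, 'e, 'k) lincomb \<Rightarrow> bool" where
  null_mor_add:
    "\<lbrakk>X \<in> Obj C; Y \<in> Obj C; f \<in> carrier (Hom C X Y n); g \<in> carrier (Hom C X Y n)\<rbrakk>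
      \<Longrightarrow> null X Y n (wd [Mor X Y n (f \<oplus>\<^bsub>Hom C X Y n\<^esub> g)] - (wd [Mor X Y n f] + wd [Mor X Y n g]))"
| null_mor_smult:
    "\<lbrakk>X \<in> Obj C; Y \<in> Obj C; f \<in> carrier (Hom C X Y n)\<rbrakk>
      \<Longrightarrow> null X Y n (wd [Mor X Y n (c \<odot>\<^bsub>Hom C X Y n\<^esub> f)] - scal c (wd [Mor X Y n f]))"
| null_mor_cmp:
    "\<lbrakk>X \<in> Obj C; Y \<in> Obj C; Z \<in> Obj C;
      g \<in> carrier (Hom C Y Z m); f \<in> carrier (Hom C X Y n)\<rbrakk>
      \<Longrightarrow> null X Z (m + n)
            (wd [Mor Y Z m g, Mor X Y n f] - wd [Mor X Z (m + n) (cmp C X Y Z m n g f)])"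
| null_mor_idt: "X \<in> Obj C \<Longrightarrow> null X X 0 (wd [Mor X X 0 (idt C X)] - wd [])"
| null_zero: "\<lbrakk>X \<in> Obj C; Y \<in> Obj C\<rbrakk> \<Longrightarrow> null X Y n 0"
| null_add: "\<lbrakk>null X Y n p; null X Y n q\<rbrakk> \<Longrightarrow> null X Y n (p + q)"
| null_scal: "null X Y n p \<Longrightarrow> null X Y n (scal c p)"
| null_left: "\<lbrakk>null X Y n p; is_word Y Z u\<rbrakk> \<Longrightarrow> null X Z (word_deg u + n) (wmul (wd u) p)"
| null_right: "\<lbrakk>null Y Z n p; is_word X Y u\<rbrakk> \<Longrightarrow> null X Z (n + word_deg u) (wmul p (wd u))"

definition residue :: "'o \<Rightarrow> 'o \<Rightarrow> int \<Rightarrow> ('o, 'm, 'e, 'k) lincomb \<Rightarrow> ('o, 'm, 'e, 'k) lincomb set"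
  where "residue X Y n p = {q \<in> free_hom X Y n. null X Y n (q - p)}"

definition adjoin_hom :: "'o \<Rightarrow> 'o \<Rightarrow> int \<Rightarrow> ('k, ('o, 'm, 'e, 'k) lincomb set) module" where
  "adjoin_hom X Y n =
     \<lparr>carrier = residue X Y n ` free_hom X Y n,
      monoid.mult = undefined,
      one = undefined,
      ring.zero = residue X Y n 0,
      ring.add = (\<lambda>P Q. \<Union>p\<in>P. \<Union>q\<in>Q. residue X Y n (p + q)),
      module.smult = (\<lambda>c P. \<Union>p\<in>P. residue X Y n (scal c p))\<rparr>"

text \<open>The dg category freely generated by \<open>C\<close> and the given generators, with the differential
  extended from letters by the Leibniz rule.\<close>

definition adjoin :: "('o, ('o, 'm, 'e, 'k) lincomb set, 'k) dgcat" where
  "adjoin =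
     \<lparr>Obj = Obj C,
      Hom = adjoin_hom,
      dif = (\<lambda>X Y n P. \<Union>p\<in>P. residue X Y (n + 1) (lin_extend word_dif p)),
      cmp = (\<lambda>X Y Z m n Q P. \<Union>q\<in>Q. \<Union>p\<in>P. residue X Z (m + n) (wmul q p)),
      idt = (\<lambda>X. residue X X 0 (wd []))\<rparr>"

definition adjoin_mor :: "'o \<Rightarrow> 'o \<Rightarrow> int \<Rightarrow> 'm \<Rightarrow> ('o, 'm, 'e, 'k) lincomb set" where
  "adjoin_mor X Y n f = residue X Y n (wd [Mor X Y n f])"

definition adjoin_eps :: "'o \<Rightarrow> 'e \<Rightarrow> ('o, 'm, 'e, 'k) lincomb set" where
  "adjoin_eps X e = residue X X (gdeg G e) (wd [Eps X e])"

end


section \<open>Drinfeld quotients\<close>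

definition drinfeld_generators :: "('o, 'm, 'k::field) dgcat \<Rightarrow> ('o, 'm, unit, 'k) generators" where
  "drinfeld_generators D =
     \<lparr>gens = (\<lambda>X. if X \<in> Obj D then {()} else {}),
      gdeg = (\<lambda>_. - 1),
      gdif = (\<lambda>X _. wd [])\<rparr>"

definition drinfeld_quotient ::
  "('o, 'm, 'k::field) dgcat \<Rightarrow> ('o, 'm, 'k) dgcat
    \<Rightarrow> ('o, ('o, 'm, unit, 'k) lincomb set, 'k) dgcat" where
  "drinfeld_quotient C D = adjoin C (drinfeld_generators D)"

text \<open>
  The generator with indices \<open>i\<^sub>1 < \<dots> < i\<^sub>s\<close> at \<open>X\<close> is \<open>Eps X [i\<^sub>1, \<dots>, i\<^sub>s]\<close>; with empty index
  list it stands for the identity, i.e. the empty word.  List positions count from 0, so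
  position \<open>t\<close> is the index \<open>i\<^bsub>t+1\<^esub>\<close>, which is where the exponent \<open>s - Suc t\<close> comes from.
\<close>

definition eps_word :: "'o \<Rightarrow> nat list \<Rightarrow> ('o, 'm, nat list) word" where
  "eps_word X is = (if is = [] then [] else [Eps X is])"

definition refined_generators ::
  "nat \<Rightarrow> (nat \<Rightarrow> ('o, 'm, 'k::field) dgcat) \<Rightarrow> ('o, 'm, nat list, 'k) generators" where
  "refined_generators k D =
     \<lparr>gens = (\<lambda>X. {is. is \<noteq> [] \<and> sorted_wrt (<) is \<and> set is \<subseteq> {1..k} \<and>
                       (\<forall>i\<in>set is. X \<in> Obj (D i))}),
      gdeg = (\<lambda>is. - int (length is)),
      gdif = (\<lambda>X is. \<Sum>t<length is.
                scal ((- 1) ^ (length is - Suc t)) (wd (eps_word X (take t is @ drop (Suc t) is))))\<rparr>"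

definition refined_drinfeld_quotient ::
  "('o, 'm, 'k::field) dgcat \<Rightarrow> nat \<Rightarrow> (nat \<Rightarrow> ('o, 'm, 'k) dgcat)
    \<Rightarrow> ('o, ('o, 'm, nat list, 'k) lincomb set, 'k) dgcat" where
  "refined_drinfeld_quotient C k D = adjoin C (refined_generators k D)"

text \<open>
  \<open>R i\<close> contains exactly one object of each isomorphism class of the full subcategory on \<open>S i\<close>,
  and all intersections of the full subcategories on the \<open>R i\<close> include as equivalences into the
  corresponding intersections for the \<open>S i\<close>.
\<close>

definition compatible_representatives ::
  "('o, 'm, 'k::field) dgcat \<Rightarrow> nat \<Rightarrow> (nat \<Rightarrow> 'o set) \<Rightarrow> (nat \<Rightarrow> 'o set) \<Rightarrow> bool" where
  "compatible_representatives C k S R \<longleftrightarrow>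
     (\<forall>i\<in>{1..k}. R i \<subseteq> S i \<and>
        (\<forall>X\<in>S i. \<exists>!Y. Y \<in> R i \<and> dg_isomorphic (full_sub C (S i)) X Y)) \<and>
     (\<forall>I. I \<subseteq> {1..k} \<and> I \<noteq> {} \<longrightarrow>
        dg_equivalence (full_sub C (\<Inter>i\<in>I. R i)) (full_sub C (\<Inter>i\<in>I. S i)) inclusion_functor)"

definition natural_quotient_functor ::
  "('o, 'm, 'k::field) dgcat \<Rightarrow> nat \<Rightarrow> (nat \<Rightarrow> ('o, 'm, 'k) dgcat) \<Rightarrow> ('o, 'm, 'k) dgcat
    \<Rightarrow> ('o, ('o, 'm, nat list, 'k) lincomb set, 'o, ('o, 'm, unit, 'k) lincomb set) dgfun \<Rightarrow> bool"
  where
  "natural_quotient_functor C k D E F \<longleftrightarrow>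
     dg_functor (refined_drinfeld_quotient C k D) (drinfeld_quotient C E) F \<and>
     (\<forall>X\<in>Obj C. fobj F X = X) \<and>
     (\<forall>X\<in>Obj C. \<forall>Y\<in>Obj C. \<forall>n. \<forall>f\<in>carrier (Hom C X Y n).
        fmor F X Y n (adjoin_mor C (refined_generators k D) X Y n f)
        = adjoin_mor C (drinfeld_generators E) X Y n f) \<and>
     (\<forall>X\<in>Obj C. \<forall>i. [i] \<in> gens (refined_generators k D) X \<longrightarrow>
        fmor F X X (- 1) (adjoin_eps C (refined_generators k D) X [i])
        = adjoin_eps C (drinfeld_generators E) X ()) \<and>
     (\<forall>X\<in>Obj C. \<forall>is\<in>gens (refined_generators k D) X. length is > 1 \<longrightarrow>
        fmor F X X (- int (length is)) (adjoin_eps C (refined_generators k D) X is)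
        = \<zero>\<^bsub>Hom (drinfeld_quotient C E) X X (- int (length is))\<^esub>)"

end

theory Submission
  imports Defs
begin

text \<open>
  The functor \<open>\<Psi>\<close> has a strict section \<open>\<Phi>\<close> such that \<open>\<Phi> \<circ> \<Psi>\<close> is chain homotopic to the identity,
  by an explicit homotopy.

  For an object \<open>X\<close> in some \<open>R i\<close>, let \<open>a\<close> be the largest index with \<open>X \<in> R a\<close>.  The differential
  of the generator \<open>\<epsilon>\<^sup>a\<close> at \<open>X\<close> is the identity, so there is a dg functor \<open>\<Phi>\<close> in the opposite
  direction which is the identity on \<open>C\<close> and sends \<open>\<epsilon>\<close> at \<open>X\<close> to \<open>\<epsilon>\<^sup>a\<close>.  Clearly
  \<open>\<Psi> \<circ> \<Phi> = id\<close>, so \<open>\<Psi>\<close> is surjective on cohomology.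

  The identity of \<open>X\<close> and the generators \<open>\<epsilon>\<^sup>I\<close> at \<open>X\<close> span the augmented chain complex of the full
  simplex on the indices \<open>i\<close> with \<open>X \<in> R i\<close>.  Coning off with the vertex \<open>a\<close> contracts it.
  Accordingly let \<open>h\<close> vanish on \<open>C\<close>, send \<open>\<epsilon>\<^sup>I\<close> to \<open>\<epsilon>\<^sup>J\<close> where \<open>J\<close> is \<open>I\<close> followed by \<open>a\<close>, or to \<open>0\<close> if
  \<open>a\<close> occurs in \<open>I\<close>, and extend it to all morphisms by
  \<open>h (g f) = h g (\<Phi> \<Psi> f) + (- 1)\<^sup>|\<^sup>g\<^sup>| g (h f)\<close>.  Then
  \<open>d h + h d\<close> and \<open>id - \<Phi> \<circ> \<Psi>\<close> agree on generators and satisfy the same product rule, hence are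
  equal.  If \<open>p\<close> is a cocycle with \<open>\<Psi> p = d q\<close>, then \<open>p = \<Phi> (d q) + d (h p) = d (\<Phi> q + h p)\<close>, so
  \<open>\<Psi>\<close> is injective on cohomology.

  Everything is computed with formal combinations of words, where maps are defined by recursion on
  letters and where the identities \<open>\<Psi> \<circ> \<Phi> = id\<close> and \<open>d h + h d = id - \<Phi> \<circ> \<Psi>\<close> hold on the nose.
  The maps descend to the quotient by the relations because substitutions of generators and
  derivations twisted by them preserve the ideal of relations (\<open>subst_null\<close>, \<open>deriv_null\<close>); the
  differential itself is a derivation twisted by the identity.  Since a dg functor out of a
  freely generated dg category is determined by its values on generators (\<open>functors_agree\<close>), the
  argument applies to every natural functor.
\<close>

section \<open>Formal linear combinations\<close>

lemma lookup_scal [simp]: "Poly_Mapping.lookup (scal c p) w = c * Poly_Mapping.lookup p w"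
  unfolding scal_def by transfer (auto simp: when_def)

interpretation lc: vector_space "scal :: 'k::field \<Rightarrow> ('w \<Rightarrow>\<^sub>0 'k) \<Rightarrow> ('w \<Rightarrow>\<^sub>0 'k)"
  by standard (rule poly_mapping_eqI, simp add: lookup_add algebra_simps)+

abbreviation lin :: "(('v \<Rightarrow>\<^sub>0 'k::field) \<Rightarrow> ('w \<Rightarrow>\<^sub>0 'k)) \<Rightarrow> bool" where
  "lin \<equiv> Vector_Spaces.linear scal scal"

lemma linI:
  assumes "\<And>p q. T (p + q) = T p + T q" "\<And>c p. T (scal c p) = scal c (T p)"
  shows "lin T"
  by (simp add: assms Vector_Spaces.linear_iff lc.vector_space_axioms)

lemma linD:
  assumes "lin T"
  shows lin_add: "T (p + q) = T p + T q" and lin_scal: "T (scal c p) = scal c (T p)"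
    and lin_zero: "T 0 = 0" and lin_diff: "T (p - q) = T p - T q"
    and lin_neg: "T (- p) = - T p" and lin_sum: "T (sum r A) = (\<Sum>a\<in>A. T (r a))"
proof -
  interpret Vector_Spaces.linear scal scal T by (rule assms)
  show "T (p + q) = T p + T q" "T (scal c p) = scal c (T p)" "T 0 = 0" "T (p - q) = T p - T q"
    "T (- p) = - T p" "T (sum r A) = (\<Sum>a\<in>A. T (r a))"
    by (rule add scale zero diff neg sum)+
qed

lemma lin_extend_superset:
  assumes "finite A" "Poly_Mapping.keys p \<subseteq> A"
  shows "lin_extend f p = (\<Sum>w\<in>A. scal (Poly_Mapping.lookup p w) (f w))"
  unfolding lin_extend_def using assms
  by (intro sum.mono_neutral_left) (auto simp: in_keys_iff)

lemma linear_lin_extend: "lin (lin_extend f)" for f :: "'v \<Rightarrow> 'w \<Rightarrow>\<^sub>0 'k::field"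
proof (rule linI)
  fix p q :: "'v \<Rightarrow>\<^sub>0 'k" and c :: 'k
  let ?A = "Poly_Mapping.keys p \<union> Poly_Mapping.keys q"
  have "lin_extend f (p + q) = (\<Sum>w\<in>?A. scal (Poly_Mapping.lookup (p + q) w) (f w))"
    by (rule lin_extend_superset) (use keys_add[of p q] in auto)
  also have "\<dots> = lin_extend f p + lin_extend f q"
    by (simp add: lookup_add lc.scale_left_distrib sum.distrib lin_extend_superset[of ?A])
  finally show "lin_extend f (p + q) = lin_extend f p + lin_extend f q" .
  have "lin_extend f (scal c p) =
      (\<Sum>w\<in>Poly_Mapping.keys p. scal (Poly_Mapping.lookup (scal c p) w) (f w))"
    by (rule lin_extend_superset) (auto simp: in_keys_iff)
  then show "lin_extend f (scal c p) = scal c (lin_extend f p)"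
    by (simp add: lin_extend_def lc.scale_sum_right)
qed

lemmas lin_extend_simps [simp] = linD[OF linear_lin_extend]

lemma lin_extend_wd [simp]: "lin_extend f (wd w) = f w"
  by (simp add: lin_extend_def)

lemma lincomb_expand: "p = lin_extend wd p"
proof (rule poly_mapping_eqI)
  fix w
  have "Poly_Mapping.lookup (lin_extend wd p) w =
      (\<Sum>v\<in>Poly_Mapping.keys p. if w = v then Poly_Mapping.lookup p v else 0)"
    unfolding lin_extend_def lookup_sum by (rule sum.cong) (auto simp: lookup_single when_def)
  also have "\<dots> = Poly_Mapping.lookup p w" by (simp add: in_keys_iff)
  finally show "Poly_Mapping.lookup p w = Poly_Mapping.lookup (lin_extend wd p) w" by simp
qed

lemma lin_extend_cong:
  "(\<And>w. w \<in> Poly_Mapping.keys p \<Longrightarrow> f w = g w) \<Longrightarrow> lin_extend f p = lin_extend g p"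
  by (simp add: lin_extend_def)

lemma lin_eq_lin_extend: "lin T \<Longrightarrow> T p = lin_extend (\<lambda>w. T (wd w)) p"
  by (subst lincomb_expand) (simp add: lin_extend_def linD)

text \<open>
  Linear maps are compared on single words; the restriction to the words that occur in \<open>p\<close> lets the
  comparison use that these words are composable and of a given degree.
\<close>

lemma lin_eqI:
  assumes "lin S" "lin T" "\<And>w. w \<in> Poly_Mapping.keys p \<Longrightarrow> S (wd w) = T (wd w)"
  shows "S p = T p"
  unfolding lin_eq_lin_extend[OF assms(1), of p] lin_eq_lin_extend[OF assms(2), of p]
  by (intro lin_extend_cong assms(3))

lemma lin_id: "lin (\<lambda>p. p)" by (rule linI) auto

lemma lin_lin_extend: "lin T \<Longrightarrow> lin (\<lambda>p. lin_extend f (T p))"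
  by (rule linI) (simp_all add: linD)

lemma lin_extend_pointwise:
  shows lin_extend_fun_add: "lin_extend (\<lambda>w. f w + g w) p = lin_extend f p + lin_extend g p"
    and lin_extend_fun_scal: "lin_extend (\<lambda>w. scal c (f w)) p = scal c (lin_extend f p)"
  by (simp_all add: lin_extend_def lc.scale_right_distrib sum.distrib lc.scale_sum_right
      mult.commute)

lemma lin_wmul_left: "lin T \<Longrightarrow> lin (\<lambda>p. wmul (T p) q)"
  unfolding wmul_def by (rule lin_lin_extend)

lemma lin_wmul_right: "lin T \<Longrightarrow> lin (\<lambda>q. wmul p (T q))"
  unfolding wmul_def by (rule linI) (simp_all add: linD lin_extend_pointwise)

lemma lin_add_fun: "lin S \<Longrightarrow> lin T \<Longrightarrow> lin (\<lambda>p. S p + T p)"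
  by (rule linI) (simp_all add: linD algebra_simps)

lemma lin_diff_fun: "lin S \<Longrightarrow> lin T \<Longrightarrow> lin (\<lambda>p. S p - T p)"
  by (rule linI) (simp_all add: linD algebra_simps)

lemma lin_scal_fun: "lin T \<Longrightarrow> lin (\<lambda>p. scal c (T p))"
  by (rule linI) (simp_all add: linD lc.scale_right_distrib mult.commute)

lemmas lin_intros =
  lin_id lin_lin_extend lin_wmul_left lin_wmul_right lin_add_fun lin_diff_fun lin_scal_fun

lemmas wmul_left_simps [simp] = linD[OF lin_wmul_left[OF lin_id]]
lemmas wmul_right_simps [simp] = linD[OF lin_wmul_right[OF lin_id]]

lemma wmul_wd [simp]: "wmul (wd u) (wd v) = wd (u @ v)"
  by (simp add: wmul_def)

lemma wmul_one_left [simp]: "wmul (wd []) p = p"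
  by (rule lin_eqI[of "\<lambda>p. wmul (wd []) p"]) (auto intro: lin_intros)

lemma wmul_one_right [simp]: "wmul p (wd []) = p"
  by (rule lin_eqI[of "\<lambda>p. wmul p (wd [])"]) (auto intro: lin_intros)

lemma wmul_assoc: "wmul (wmul p q) r = wmul p (wmul q r)"
proof (rule lin_eqI[of "\<lambda>p. wmul (wmul p q) r"])
  fix u
  show "wmul (wmul (wd u) q) r = wmul (wd u) (wmul q r)"
  proof (rule lin_eqI[of "\<lambda>q. wmul (wmul (wd u) q) r"])
    fix v
    show "wmul (wmul (wd u) (wd v)) r = wmul (wd u) (wmul (wd v) r)"
      by (rule lin_eqI[of "\<lambda>r. wmul (wmul (wd u) (wd v)) r"]) (auto intro!: lin_intros)
  qed (auto intro!: lin_intros)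
qed (auto intro!: lin_intros)

section \<open>Graded combinations of words and the ideal of relations\<close>

lemma is_word_objs: "is_word C G X Y w \<Longrightarrow> X \<in> Obj C \<and> Y \<in> Obj C"
proof (induction w arbitrary: Y)
  case (Cons l w)
  then show ?case by (cases l) auto
qed auto

lemma is_word_append:
  "is_word C G X Z (u @ v) \<longleftrightarrow> (\<exists>Y. is_word C G Y Z u \<and> is_word C G X Y v)"
proof (induction u arbitrary: Z)
  case Nil
  then show ?case using is_word_objs[of C G X Z v] by auto
next
  case (Cons l u)
  then show ?case by (cases l) auto
qed

lemma is_word_Cons:
  "is_word C G X Z (l # v) \<longleftrightarrow> (\<exists>Y. is_word C G Y Z [l] \<and> is_word C G X Y v)"
  using is_word_append[of C G X Z "[l]" v] by simp

lemma word_deg_simps [simp]: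
  "word_deg G [] = 0" "word_deg G (l # w) = letter_deg G l + word_deg G w"
  "word_deg G (u @ v) = word_deg G u + word_deg G v"
  by (simp_all add: word_deg_def)

lemma free_hom_wd [simp]:
  "wd w \<in> free_hom C G X Y n \<longleftrightarrow> is_word C G X Y w \<and> word_deg G w = n"
  by (simp add: free_hom_def)

lemma free_hom_zero [simp]: "0 \<in> free_hom C G X Y n"
  by (simp add: free_hom_def)

lemma free_hom_add [intro]:
  "p \<in> free_hom C G X Y n \<Longrightarrow> q \<in> free_hom C G X Y n \<Longrightarrow> p + q \<in> free_hom C G X Y n"
  using keys_add[of p q] by (auto simp: free_hom_def)

lemma free_hom_scal [intro]: "p \<in> free_hom C G X Y n \<Longrightarrow> scal c p \<in> free_hom C G X Y n"
  by (auto simp: free_hom_def in_keys_iff)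

lemma free_hom_neg [intro]: "p \<in> free_hom C G X Y n \<Longrightarrow> - p \<in> free_hom C G X Y n"
  by (auto simp: free_hom_def)

lemma free_hom_diff [intro]:
  "p \<in> free_hom C G X Y n \<Longrightarrow> q \<in> free_hom C G X Y n \<Longrightarrow> p - q \<in> free_hom C G X Y n"
  using free_hom_add[OF _ free_hom_neg] by fastforce

lemma free_hom_sum [intro]:
  "(\<And>a. a \<in> A \<Longrightarrow> r a \<in> free_hom C G X Y n) \<Longrightarrow> sum r A \<in> free_hom C G X Y n"
  by (induction A rule: infinite_finite_induct) auto

lemma free_hom_lin:
  assumes "lin T" "p \<in> free_hom C G X Y n"
    and "\<And>w. is_word C G X Y w \<Longrightarrow> word_deg G w = n \<Longrightarrow> T (wd w) \<in> free_hom C' G' X' Y' n'"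
  shows "T p \<in> free_hom C' G' X' Y' n'"
  unfolding lin_eq_lin_extend[OF assms(1), of p] lin_extend_def
  by (intro free_hom_sum free_hom_scal assms(3)) (use assms(2) in \<open>auto simp: free_hom_def\<close>)

lemma lin_eqI_free_hom:
  assumes "lin S" "lin T" "p \<in> free_hom C G X Y n"
    and "\<And>w. is_word C G X Y w \<Longrightarrow> word_deg G w = n \<Longrightarrow> S (wd w) = T (wd w)"
  shows "S p = T p"
  by (rule lin_eqI[OF assms(1,2)]) (use assms(3,4) in \<open>auto simp: free_hom_def\<close>)

lemma free_hom_wmul [intro]:
  assumes p: "p \<in> free_hom C G Y Z m" and q: "q \<in> free_hom C G X Y n"
  shows "wmul p q \<in> free_hom C G X Z (m + n)"
proof (rule free_hom_lin[OF _ p])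
  fix u assume u: "is_word C G Y Z u" "word_deg G u = m"
  show "wmul (wd u) q \<in> free_hom C G X Z (m + n)"
  proof (rule free_hom_lin[OF _ q])
    fix v assume "is_word C G X Y v" "word_deg G v = n"
    with u show "wmul (wd u) (wd v) \<in> free_hom C G X Z (m + n)"
      by (auto simp: is_word_append)
  qed (intro lin_intros)
qed (intro lin_intros)

lemma null_neg: "null C G X Y n p \<Longrightarrow> null C G X Y n (- p)"
  using null_scal[of C G X Y n p "- 1"] by simp

lemma null_diff: "null C G X Y n p \<Longrightarrow> null C G X Y n q \<Longrightarrow> null C G X Y n (p - q)"
  using null_add[of C G X Y n p "- q"] null_neg by fastforce

lemma null_sum:
  assumes "X \<in> Obj C" "Y \<in> Obj C" "\<And>a. a \<in> A \<Longrightarrow> null C G X Y n (r a)"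
  shows "null C G X Y n (sum r A)"
  using assms(3) by (induction A rule: infinite_finite_induct) (auto intro: null_zero null_add assms)

lemma null_lin:
  assumes "lin T" "p \<in> free_hom C G X Y n" "X' \<in> Obj C'" "Y' \<in> Obj C'"
    and "\<And>w. is_word C G X Y w \<Longrightarrow> word_deg G w = n \<Longrightarrow> null C' G' X' Y' n' (T (wd w))"
  shows "null C' G' X' Y' n' (T p)"
  unfolding lin_eq_lin_extend[OF assms(1), of p] lin_extend_def
  by (intro null_sum null_scal assms) (use assms(2) in \<open>auto simp: free_hom_def\<close>)

context dg_category
begin

lemma hom_closed [intro]:
  assumes "X \<in> Obj C" "Y \<in> Obj C"
  shows hom_zero: "\<zero>\<^bsub>Hom C X Y n\<^esub> \<in> carrier (Hom C X Y n)"
    and hom_add: "f \<in> carrier (Hom C X Y n) \<Longrightarrow> g \<in> carrier (Hom C X Y n) \<Longrightarrow>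
      f \<oplus>\<^bsub>Hom C X Y n\<^esub> g \<in> carrier (Hom C X Y n)"
    and hom_smult: "f \<in> carrier (Hom C X Y n) \<Longrightarrow> c \<odot>\<^bsub>Hom C X Y n\<^esub> f \<in> carrier (Hom C X Y n)"
proof -
  interpret module "ring_of_type_algebra :: 'k ring" "Hom C X Y n" by (rule hom_module[OF assms])
  show "\<zero>\<^bsub>Hom C X Y n\<^esub> \<in> carrier (Hom C X Y n)"
    "f \<in> carrier (Hom C X Y n) \<Longrightarrow> g \<in> carrier (Hom C X Y n) \<Longrightarrow>
      f \<oplus>\<^bsub>Hom C X Y n\<^esub> g \<in> carrier (Hom C X Y n)"
    "f \<in> carrier (Hom C X Y n) \<Longrightarrow> c \<odot>\<^bsub>Hom C X Y n\<^esub> f \<in> carrier (Hom C X Y n)"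
    using smult_closed[of c f] by (auto simp: ring_of_type_algebra_def)
qed

lemma dif_closed [intro]:
  "\<lbrakk>X \<in> Obj C; Y \<in> Obj C; f \<in> carrier (Hom C X Y n)\<rbrakk> \<Longrightarrow>
    dif C X Y n f \<in> carrier (Hom C X Y (n + 1))"
  using dif_linear[of X Y n] by (auto simp: klinear_def)

lemma cmp_closed [intro]:
  "\<lbrakk>X \<in> Obj C; Y \<in> Obj C; Z \<in> Obj C; g \<in> carrier (Hom C Y Z m); f \<in> carrier (Hom C X Y n)\<rbrakk>
    \<Longrightarrow> cmp C X Y Z m n g f \<in> carrier (Hom C X Z (m + n))"
  using cmp_linear_left[of X Y Z f n m] by (auto simp: klinear_def)

lemma smult_zero_hom:
  assumes "X \<in> Obj C" "Y \<in> Obj C" "f \<in> carrier (Hom C X Y n)"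
  shows "0 \<odot>\<^bsub>Hom C X Y n\<^esub> f = \<zero>\<^bsub>Hom C X Y n\<^esub>"
proof -
  interpret module "ring_of_type_algebra :: 'k ring" "Hom C X Y n"
    by (rule hom_module) fact+
  show ?thesis using smult_l_null[OF assms(3)] by (simp add: ring_of_type_algebra_def)
qed

lemma null_free_hom:
  "null C G X Y n p \<Longrightarrow> X \<in> Obj C \<and> Y \<in> Obj C \<and> p \<in> free_hom C G X Y n"
proof (induction rule: null.induct)
  case (null_left X Y n p Z u)
  then show ?case using is_word_objs[of C G Y Z u] by (auto intro!: free_hom_wmul)
next
  case (null_right Y Z n p X u)
  then show ?case using is_word_objs[of C G X Y u] by (auto intro!: free_hom_wmul)
qed (auto intro!: free_hom_diff free_hom_add free_hom_scal idt_closed)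

lemma null_wmul_left:
  assumes p: "null C G X Y n p" and q: "q \<in> free_hom C G Y Z m" and Z: "Z \<in> Obj C"
  shows "null C G X Z (m + n) (wmul q p)"
proof (rule null_lin[OF _ q _ Z])
  fix w assume "is_word C G Y Z w" "word_deg G w = m"
  then show "null C G X Z (m + n) (wmul (wd w) p)" using null_left[OF p] by auto
qed (use null_free_hom[OF p] in \<open>auto intro!: lin_intros\<close>)

lemma null_wmul_right:
  assumes p: "null C G Y Z n p" and q: "q \<in> free_hom C G X Y m" and X: "X \<in> Obj C"
  shows "null C G X Z (n + m) (wmul p q)"
proof (rule null_lin[OF _ q X])
  fix w assume "is_word C G X Y w" "word_deg G w = m"
  then show "null C G X Z (n + m) (wmul p (wd w))" using null_right[OF p] by auto
qed (use null_free_hom[OF p] in \<open>auto intro!: lin_intros\<close>)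

lemma null_mor_zero:
  assumes "X \<in> Obj C" "Y \<in> Obj C"
  shows "null C G X Y n (wd [Mor X Y n \<zero>\<^bsub>Hom C X Y n\<^esub>])"
  using null_mor_smult[OF assms hom_zero[OF assms], of G n 0] smult_zero_hom[OF assms hom_zero[OF assms]]
  by simp

text \<open>
  Differentiating \<open>id \<circ> id = id\<close> gives \<open>d id = d id + d id\<close>.
\<close>

lemma dif_idt:
  assumes X: "X \<in> Obj C"
  shows "dif C X X 0 (idt C X) = \<zero>\<^bsub>Hom C X X 1\<^esub>"
proof -
  interpret module "ring_of_type_algebra :: 'k ring" "Hom C X X 1" by (rule hom_module[OF X X])
  let ?d = "dif C X X 0 (idt C X)"
  have d: "?d \<in> carrier (Hom C X X 1)" using dif_closed[OF X X idt_closed[OF X]] by simp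
  have "?d = cmp C X X X 1 0 ?d (idt C X) \<oplus>\<^bsub>Hom C X X 1\<^esub>
      1 \<odot>\<^bsub>Hom C X X 1\<^esub> cmp C X X X 0 1 (idt C X) ?d"
    using leibniz[OF X X X idt_closed[OF X] idt_closed[OF X]] idt_left[OF X X idt_closed[OF X]]
    by simp
  also have "\<dots> = ?d \<oplus>\<^bsub>Hom C X X 1\<^esub> ?d"
    using idt_left[OF X X d] idt_right[OF X X d] smult_one[OF d]
    by (simp add: ring_of_type_algebra_def)
  finally show ?thesis using d by (metis M.add.l_cancel_one')
qed

end


section \<open>Substitutions and twisted derivations of words\<close>

abbreviation koszul :: "int \<Rightarrow> 'k::field" where
  "koszul n \<equiv> (- 1) powi n"

lemma koszul_simps:
  "koszul (m + n) = koszul m * (koszul n :: 'k::field)"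
  "koszul m * koszul m = (1 :: 'k)" "koszul m * (koszul m * c) = (c :: 'k)"
proof -
  show *: "koszul (m + n) = koszul m * (koszul n :: 'k)" for m n by (simp add: power_int_add)
  show "koszul m * koszul m = (1 :: 'k)" by (simp add: power_int_mult_distrib[symmetric])
  then show "koszul m * (koszul m * c) = (c :: 'k)" by (metis mult.assoc mult_1)
qed

text \<open>
  The multiplicative extension of a substitution of letters by combinations of words.
\<close>

fun sub :: "('l \<Rightarrow> ('v list \<Rightarrow>\<^sub>0 'k::field)) \<Rightarrow> 'l list \<Rightarrow> ('v list \<Rightarrow>\<^sub>0 'k)" where
  "sub \<sigma> [] = wd []"
| "sub \<sigma> (l # w) = wmul (\<sigma> l) (sub \<sigma> w)"

lemma sub_append: "sub \<sigma> (u @ v) = wmul (sub \<sigma> u) (sub \<sigma> v)"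
  by (induction u) (simp_all add: wmul_assoc)

lemma sub_wd: "sub (\<lambda>l. wd [l]) w = wd w"
  by (induction w) simp_all

lemma sub_wmul:
  "lin_extend (sub \<sigma>) (wmul p q) = wmul (lin_extend (sub \<sigma>) p) (lin_extend (sub \<sigma>) q)"
proof (rule lin_eqI[of "\<lambda>p. lin_extend (sub \<sigma>) (wmul p q)"])
  fix u
  show "lin_extend (sub \<sigma>) (wmul (wd u) q) = wmul (lin_extend (sub \<sigma>) (wd u)) (lin_extend (sub \<sigma>) q)"
    by (rule lin_eqI[of "\<lambda>q. lin_extend (sub \<sigma>) (wmul (wd u) q)"])
      (auto intro!: lin_intros simp: sub_append)
qed (intro lin_intros)+

lemma sub_sub: "lin_extend (sub \<sigma>) (sub \<rho> w) = sub (\<lambda>l. lin_extend (sub \<sigma>) (\<rho> l)) w"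
  by (induction w) (simp_all add: sub_wmul)

text \<open>
  The extension of \<open>\<delta>\<close> from letters to words as a graded derivation twisted by \<open>\<sigma>\<close>, that is, with the
  product rule \<open>\<delta> (u v) = \<delta> u (\<sigma> v) + (- 1)\<^sup>|\<^sup>u\<^sup>| u (\<delta> v)\<close>.  A map \<open>\<delta>\<close> of odd degree is intended: degree \<open>1\<close>
  with \<open>\<sigma>\<close> the identity gives the differential, and degree \<open>- 1\<close> gives homotopies from \<open>\<sigma>\<close> to the
  identity.
\<close>

fun der ::
  "('l \<Rightarrow> int) \<Rightarrow> ('l \<Rightarrow> ('l list \<Rightarrow>\<^sub>0 'k::field)) \<Rightarrow> ('l \<Rightarrow> ('l list \<Rightarrow>\<^sub>0 'k)) \<Rightarrow> 'l list
    \<Rightarrow> ('l list \<Rightarrow>\<^sub>0 'k)" where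
  "der d \<sigma> \<delta> [] = 0"
| "der d \<sigma> \<delta> (l # w) =
     wmul (\<delta> l) (sub \<sigma> w) + scal (koszul (d l)) (wmul (wd [l]) (der d \<sigma> \<delta> w))"

lemma word_dif_der: "word_dif C G = der (letter_deg G) (\<lambda>l. wd [l]) (letter_dif C G)"
proof
  fix w show "word_dif C G w = der (letter_deg G) (\<lambda>l. wd [l]) (letter_dif C G) w"
    by (induction w) (simp_all add: sub_wd)
qed

lemma wmul_wd_append: "wmul (wd (u @ v)) p = wmul (wd u) (wmul (wd v) p)"
  by (simp add: wmul_assoc[symmetric])

lemma der_append:
  "der (letter_deg G) \<sigma> \<delta> (u @ v) = wmul (der (letter_deg G) \<sigma> \<delta> u) (sub \<sigma> v)
     + scal (koszul (word_deg G u)) (wmul (wd u) (der (letter_deg G) \<sigma> \<delta> v))"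
proof (induction u)
  case (Cons l u)
  show ?case
    by (simp add: wmul_wd_append[of "[l]" u, simplified] Cons sub_append wmul_assoc koszul_simps lc.scale_right_distrib add.assoc)
qed simp

text \<open>
  Homogeneity of the left factor is what turns the sign into a scalar.
\<close>

lemma der_wmul:
  assumes p: "p \<in> free_hom C G Y Z m"
  shows "lin_extend (der (letter_deg G) \<sigma> \<delta>) (wmul p q) =
      wmul (lin_extend (der (letter_deg G) \<sigma> \<delta>) p) (lin_extend (sub \<sigma>) q)
     + scal (koszul m) (wmul p (lin_extend (der (letter_deg G) \<sigma> \<delta>) q))" (is "?L p q = ?R p q")
proof (rule lin_eqI_free_hom[OF _ _ p, of "\<lambda>p. ?L p q"])
  fix u assume u: "word_deg G u = m"
  show "?L (wd u) q = ?R (wd u) q"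
    by (rule lin_eqI[of "?L (wd u)"]) (auto intro!: lin_intros simp: der_append u)
qed (intro lin_intros)+

lemma word_dif_wmul:
  fixes p q :: "('o, 'm, 'e, 'k::field) lincomb"
  assumes p: "p \<in> free_hom C' G Y Z m"
  shows "lin_extend (word_dif C G) (wmul p q) = wmul (lin_extend (word_dif C G) p) q
     + scal (koszul m) (wmul p (lin_extend (word_dif C G) q))"
proof -
  have "sub (\<lambda>l. wd [l]) = (wd :: ('o, 'm, 'e) word \<Rightarrow> _ \<Rightarrow>\<^sub>0 'k)" by (rule ext) (rule sub_wd)
  then show ?thesis
    unfolding word_dif_der der_wmul[OF p] by (simp flip: lincomb_expand)
qed

text \<open>
  Dg functors that are the identity on \<open>C\<close> come from substitutions that only touch the adjoined
  generators.
\<close>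

fun letter_subst ::
  "('o \<Rightarrow> 'e \<Rightarrow> ('o, 'm, 'f, 'k) lincomb) \<Rightarrow> ('o, 'm, 'e) letter \<Rightarrow> ('o, 'm, 'f, 'k::field) lincomb"
where
  "letter_subst \<tau> (Mor A B n f) = wd [Mor A B n f]"
| "letter_subst \<tau> (Eps A e) = \<tau> A e"

abbreviation subst ::
  "('o \<Rightarrow> 'e \<Rightarrow> ('o, 'm, 'f, 'k) lincomb) \<Rightarrow> ('o, 'm, 'e, 'k) lincomb \<Rightarrow> ('o, 'm, 'f, 'k::field) lincomb"
where "subst \<tau> \<equiv> lin_extend (sub (letter_subst \<tau>))"

lemma letter_subst_Eps: "letter_subst (\<lambda>X e. wd [Eps X e]) = (\<lambda>l. wd [l])"
proof
  fix l :: "('a, 'b, 'c) letter"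
  show "letter_subst (\<lambda>X e. wd [Eps X e]) l = wd [l]" by (cases l) auto
qed

lemma subst_Eps: "subst (\<lambda>X e. wd [Eps X e]) p = p"
  by (rule lin_eqI[of "subst (\<lambda>X e. wd [Eps X e])" "\<lambda>p. p"])
    (auto intro!: lin_intros simp: letter_subst_Eps sub_wd)

lemma subst_subst: "subst \<tau> (subst \<tau>' p) = subst (\<lambda>X e. subst \<tau> (\<tau>' X e)) p"
proof -
  have "(\<lambda>l. subst \<tau> (letter_subst \<tau>' l)) = letter_subst (\<lambda>X e. subst \<tau> (\<tau>' X e))"
  proof
    fix l show "subst \<tau> (letter_subst \<tau>' l) = letter_subst (\<lambda>X e. subst \<tau> (\<tau>' X e)) l"
      by (cases l) auto
  qed
  note * = this
  show ?thesis
    by (rule lin_eqI[where S = "\<lambda>p. subst \<tau> (subst \<tau>' p)"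
          and T = "subst (\<lambda>X e. subst \<tau> (\<tau>' X e))"])
      (auto intro!: lin_intros linear_lin_extend simp: sub_sub *)
qed

locale substitution = dg_category C
  for C :: "('o, 'm, 'k::field) dgcat" +
  fixes G :: "('o, 'm, 'e, 'k) generators" and G' :: "('o, 'm, 'f, 'k) generators"
    and \<tau> :: "'o \<Rightarrow> 'e \<Rightarrow> ('o, 'm, 'f, 'k) lincomb"
  assumes subst_gen:
    "\<lbrakk>X \<in> Obj C; e \<in> gens G X\<rbrakk> \<Longrightarrow> \<tau> X e \<in> free_hom C G' X X (gdeg G e)"
begin

lemma letter_subst_free_hom:
  "is_word C G X Y [l] \<Longrightarrow> letter_subst \<tau> l \<in> free_hom C G' X Y (letter_deg G l)"
  by (cases l) (auto intro: subst_gen)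

lemma sub_free_hom:
  "is_word C G X Y w \<Longrightarrow> sub (letter_subst \<tau>) w \<in> free_hom C G' X Y (word_deg G w)"
proof (induction w arbitrary: Y)
  case (Cons l w)
  from Cons.prems obtain Z where "is_word C G Z Y [l]" "is_word C G X Z w"
    by (subst (asm) is_word_Cons) auto
  then show ?case by (auto intro!: free_hom_wmul Cons.IH letter_subst_free_hom)
qed auto

lemma subst_free_hom:
  "p \<in> free_hom C G X Y n \<Longrightarrow> subst \<tau> p \<in> free_hom C G' X Y n"
  by (erule free_hom_lin[OF linear_lin_extend]) (auto intro: sub_free_hom)

text \<open>
  A substitution fixes each of the defining relations, because these only involve morphisms of \<open>C\<close>; being
  multiplicative, it preserves the ideal that they generate.
\<close>

lemma subst_null: "null C G X Y n p \<Longrightarrow> null C G' X Y n (subst \<tau> p)"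
proof (induction rule: null.induct)
  case (null_mor_cmp X Y Z g m f n)
  then show ?case using null.null_mor_cmp[of X C Y Z g m f n] by simp
next
  case (null_left X Y n p Z u)
  then show ?case using is_word_objs[of C G Y Z u]
    by (auto simp: sub_wmul intro!: null_wmul_left sub_free_hom)
next
  case (null_right Y Z n p X u)
  then show ?case using is_word_objs[of C G X Y u]
    by (auto simp: sub_wmul intro!: null_wmul_right sub_free_hom)
qed (simp_all add: null.intros)

end

text \<open>
  The last four assumptions say that \<open>\<delta>\<close> maps the defining relations into the ideal of relations:
  additivity, homogeneity, composition and identities.  The third is the product rule for a composite
  of two morphisms of \<open>C\<close>; in the fourth, the empty word is killed by any derivation.
\<close>

locale twisted_derivation = substitution C G G \<tau>
  for C :: "('o, 'm, 'k::field) dgcat" and G :: "('o, 'm, 'e, 'k) generators" and \<tau> +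
  fixes \<delta> :: "('o, 'm, 'e) letter \<Rightarrow> ('o, 'm, 'e, 'k) lincomb" and r :: int
  assumes letter_closed:
      "is_word C G X Y [l] \<Longrightarrow> \<delta> l \<in> free_hom C G X Y (letter_deg G l + r)"
    and letter_add:
      "\<lbrakk>X \<in> Obj C; Y \<in> Obj C; f \<in> carrier (Hom C X Y n); g \<in> carrier (Hom C X Y n)\<rbrakk> \<Longrightarrow>
        null C G X Y (n + r) (\<delta> (Mor X Y n (f \<oplus>\<^bsub>Hom C X Y n\<^esub> g)) - (\<delta> (Mor X Y n f) + \<delta> (Mor X Y n g)))"
    and letter_smult:
      "\<lbrakk>X \<in> Obj C; Y \<in> Obj C; f \<in> carrier (Hom C X Y n)\<rbrakk> \<Longrightarrow>
        null C G X Y (n + r) (\<delta> (Mor X Y n (c \<odot>\<^bsub>Hom C X Y n\<^esub> f)) - scal c (\<delta> (Mor X Y n f)))"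
    and letter_cmp:
      "\<lbrakk>X \<in> Obj C; Y \<in> Obj C; Z \<in> Obj C; g \<in> carrier (Hom C Y Z m); f \<in> carrier (Hom C X Y n)\<rbrakk> \<Longrightarrow>
        null C G X Z (m + n + r)
          (wmul (\<delta> (Mor Y Z m g)) (wd [Mor X Y n f])
            + scal (koszul m) (wmul (wd [Mor Y Z m g]) (\<delta> (Mor X Y n f)))
            - \<delta> (Mor X Z (m + n) (cmp C X Y Z m n g f)))"
    and letter_idt: "X \<in> Obj C \<Longrightarrow> null C G X X r (\<delta> (Mor X X 0 (idt C X)))"
begin

abbreviation "word_der \<equiv> der (letter_deg G) (letter_subst \<tau>) \<delta>"
abbreviation "deriv \<equiv> lin_extend word_der"

lemma word_der_free_hom:
  "is_word C G X Y w \<Longrightarrow> word_der w \<in> free_hom C G X Y (word_deg G w + r)"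
proof (induction w arbitrary: Y)
  case (Cons l w)
  from Cons.prems obtain Z where l: "is_word C G Z Y [l]" and w: "is_word C G X Z w"
    by (subst (asm) is_word_Cons) auto
  have "wmul (\<delta> l) (sub (letter_subst \<tau>) w)
      \<in> free_hom C G X Y ((letter_deg G l + r) + word_deg G w)"
    by (rule free_hom_wmul[OF letter_closed[OF l] sub_free_hom[OF w]])
  moreover have "wmul (wd [l]) (word_der w)
      \<in> free_hom C G X Y (letter_deg G l + (word_deg G w + r))"
    using l by (intro free_hom_wmul[OF _ Cons.IH[OF w]]) auto
  ultimately show ?case by (auto simp: algebra_simps)
qed auto

lemma deriv_free_hom:
  "p \<in> free_hom C G X Y n \<Longrightarrow> deriv p \<in> free_hom C G X Y (n + r)"
  by (erule free_hom_lin[OF linear_lin_extend]) (auto intro: word_der_free_hom)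

text \<open>
  By the product rule, a twisted derivation takes \<open>u p\<close> with \<open>p\<close> null to a combination of
  \<open>\<delta> u (\<sigma> p)\<close> and \<open>u (\<delta> p)\<close>, which are null because \<open>\<sigma>\<close> and, inductively, \<open>\<delta>\<close> preserve relations; and
  similarly on the other side.
\<close>

lemma deriv_null: "null C G X Y n p \<Longrightarrow> null C G X Y (n + r) (deriv p)"
proof (induction rule: null.induct)
  case (null_mor_cmp X Y Z g m f n)
  then show ?case using letter_cmp[of X Y Z g m f n] by simp
next
  case (null_left X Y n p Z u)
  have Z: "Z \<in> Obj C" using null_left is_word_objs[of C G Y Z u] by auto
  have u: "wd u \<in> free_hom C G Y Z (word_deg G u)" using null_left by auto
  have "null C G X Z (word_deg G u + r + n) (wmul (word_der u) (subst \<tau> p))"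
    using null_left by (intro null_wmul_left subst_null word_der_free_hom Z) auto
  moreover have "null C G X Z (word_deg G u + (n + r)) (wmul (wd u) (deriv p))"
    using null_left by (intro null_wmul_left Z) auto
  ultimately show ?case
    using der_wmul[OF u] by (auto simp: algebra_simps intro: null_add null_scal)
next
  case (null_right Y Z n p X u)
  have X: "X \<in> Obj C" using null_right is_word_objs[of C G X Y u] by auto
  have p: "p \<in> free_hom C G Y Z n" using null_right null_free_hom by blast
  have "null C G X Z (n + r + word_deg G u) (wmul (deriv p) (subst \<tau> (wd u)))"
    using null_right by (intro null_wmul_right subst_free_hom X) auto
  moreover have "null C G X Z (n + (word_deg G u + r)) (wmul p (word_der u))"
    using null_right by (intro null_wmul_right word_der_free_hom X) auto
  ultimately show ?case
    using der_wmul[OF p] by (auto simp: algebra_simps intro: null_add null_scal)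
qed (simp_all add: null.null_zero null.null_add null.null_scal letter_add letter_smult letter_idt)

end

section \<open>The dg category generated by adjoined endomorphisms\<close>

context dg_category
begin

lemma residue_self:
  "\<lbrakk>X \<in> Obj C; Y \<in> Obj C; p \<in> free_hom C G X Y n\<rbrakk> \<Longrightarrow> p \<in> residue C G X Y n p"
  by (simp add: residue_def null_zero)

lemma residue_eqI:
  assumes "p \<in> free_hom C G X Y n" "q \<in> free_hom C G X Y n" "null C G X Y n (p - q)"
  shows "residue C G X Y n p = residue C G X Y n q"
proof -
  have *: "null C G X Y n (r - p) \<longleftrightarrow> null C G X Y n (r - q)" for r
    using null_add[OF _ assms(3), of "r - p"] null_diff[OF _ assms(3), of "r - q"] by auto
  show ?thesis by (simp add: residue_def *)
qed

lemma residue_eq_iff: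
  assumes "X \<in> Obj C" "Y \<in> Obj C" "p \<in> free_hom C G X Y n" "q \<in> free_hom C G X Y n"
  shows "residue C G X Y n p = residue C G X Y n q \<longleftrightarrow> null C G X Y n (p - q)"
proof
  assume "residue C G X Y n p = residue C G X Y n q"
  then have "p \<in> residue C G X Y n q" using residue_self[OF assms(1-3)] by simp
  then show "null C G X Y n (p - q)" by (simp add: residue_def)
qed (rule residue_eqI[OF assms(3,4)])

lemma residue_zero_iff:
  assumes "X \<in> Obj C" "Y \<in> Obj C" "p \<in> free_hom C G X Y n"
  shows "residue C G X Y n p = residue C G X Y n 0 \<longleftrightarrow> null C G X Y n p"
  using residue_eq_iff[OF assms, of 0] by simp

end

text \<open>
  The linear maps that pass to residue classes, from morphisms \<open>X \<rightarrow> Y\<close> of degree \<open>n\<close> to morphisms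
  \<open>X' \<rightarrow> Y'\<close> of degree \<open>n'\<close>; \<open>induced\<close> is the resulting map of classes.
\<close>

definition descends ::
  "('o, 'm, 'k::field) dgcat \<Rightarrow> ('o, 'm, 'e, 'k) generators \<Rightarrow> ('o, 'm, 'f, 'k) generators \<Rightarrow>
    'o \<Rightarrow> 'o \<Rightarrow> int \<Rightarrow> 'o \<Rightarrow> 'o \<Rightarrow> int \<Rightarrow> (('o, 'm, 'e, 'k) lincomb \<Rightarrow> ('o, 'm, 'f, 'k) lincomb) \<Rightarrow> bool"
where
  "descends C G G' X Y n X' Y' n' T \<longleftrightarrow> lin T \<and>
    (\<forall>p\<in>free_hom C G X Y n. T p \<in> free_hom C G' X' Y' n') \<and>
    (\<forall>p. null C G X Y n p \<longrightarrow> null C G' X' Y' n' (T p))"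

definition induced ::
  "('o, 'm, 'k::field) dgcat \<Rightarrow> ('o, 'm, 'f, 'k) generators \<Rightarrow> 'o \<Rightarrow> 'o \<Rightarrow> int \<Rightarrow>
    (('o, 'm, 'e, 'k) lincomb \<Rightarrow> ('o, 'm, 'f, 'k) lincomb) \<Rightarrow>
    ('o, 'm, 'e, 'k) lincomb set \<Rightarrow> ('o, 'm, 'f, 'k) lincomb set" where
  "induced C G X Y n T P = (\<Union>p\<in>P. residue C G X Y n (T p))"

lemma adjoin_simps [simp]:
  "Obj (adjoin C G) = Obj C"
  "Hom (adjoin C G) = adjoin_hom C G"
  "dif (adjoin C G) X Y n = induced C G X Y (n + 1) (lin_extend (word_dif C G))"
  "idt (adjoin C G) X = residue C G X X 0 (wd [])"
  "carrier (adjoin_hom C G X Y n) = residue C G X Y n ` free_hom C G X Y n"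
  "\<zero>\<^bsub>adjoin_hom C G X Y n\<^esub> = residue C G X Y n 0"
  by (simp_all add: adjoin_def adjoin_hom_def induced_def fun_eq_iff)

context dg_category
begin

context
  fixes X Y :: 'o
  assumes XY: "X \<in> Obj C" "Y \<in> Obj C"
begin

lemma induced_residue:
  assumes T: "descends C G G' X Y n X' Y' n' T" and p: "p \<in> free_hom C G X Y n"
  shows "induced C G' X' Y' n' T (residue C G X Y n p) = residue C G' X' Y' n' (T p)"
proof -
  have "residue C G' X' Y' n' (T q) = residue C G' X' Y' n' (T p)"
    if "q \<in> residue C G X Y n p" for q
  proof (rule residue_eqI)
    have q: "q \<in> free_hom C G X Y n" "null C G X Y n (q - p)"
      using that by (simp_all add: residue_def)
    from T have "lin T" by (simp add: descends_def)
    then have "T q - T p = T (q - p)" by (rule lin_diff[symmetric])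
    with T q show "null C G' X' Y' n' (T q - T p)" by (simp add: descends_def)
    from T p q show "T q \<in> free_hom C G' X' Y' n'" "T p \<in> free_hom C G' X' Y' n'"
      by (simp_all add: descends_def)
  qed
  then show ?thesis unfolding induced_def using residue_self[OF XY p] by blast
qed

lemma add_residue:
  assumes p: "p \<in> free_hom C G X Y n" and q: "q \<in> free_hom C G X Y n"
  shows "residue C G X Y n p \<oplus>\<^bsub>adjoin_hom C G X Y n\<^esub> residue C G X Y n q = residue C G X Y n (p + q)"
proof -
  have "residue C G X Y n (p' + q') = residue C G X Y n (p + q)"
    if "p' \<in> residue C G X Y n p" "q' \<in> residue C G X Y n q" for p' q'
  proof (rule residue_eqI)
    have "null C G X Y n ((p' - p) + (q' - q))"
      using that by (intro null_add) (auto simp: residue_def)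
    then show "null C G X Y n (p' + q' - (p + q))" by (simp add: algebra_simps)
  qed (use p q that in \<open>auto simp: residue_def\<close>)
  then have "(\<Union>p'\<in>residue C G X Y n p. \<Union>q'\<in>residue C G X Y n q. residue C G X Y n (p' + q'))
      = residue C G X Y n (p + q)"
    using residue_self[OF XY p] residue_self[OF XY q] by blast
  then show ?thesis by (simp add: adjoin_hom_def)
qed

lemma smult_residue:
  assumes p: "p \<in> free_hom C G X Y n"
  shows "c \<odot>\<^bsub>adjoin_hom C G X Y n\<^esub> residue C G X Y n p = residue C G X Y n (scal c p)"
proof -
  have "descends C G G X Y n X Y n (scal c)"
    unfolding descends_def by (auto intro: null_scal lin_scal_fun[OF lin_id])
  from induced_residue[OF this p] show ?thesis by (simp add: adjoin_hom_def induced_def)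
qed

lemma module_adjoin_hom: "module (ring_of_type_algebra :: 'k ring) (adjoin_hom C G X Y n)"
proof (rule moduleI)
  show "abelian_group (adjoin_hom C G X Y n)"
  proof (rule abelian_groupI)
    fix P assume "P \<in> carrier (adjoin_hom C G X Y n)"
    then obtain p where p: "p \<in> free_hom C G X Y n" "P = residue C G X Y n p" by auto
    then show "\<exists>Q\<in>carrier (adjoin_hom C G X Y n). Q \<oplus>\<^bsub>adjoin_hom C G X Y n\<^esub> P = \<zero>\<^bsub>adjoin_hom C G X Y n\<^esub>"
      by (intro bexI[of _ "residue C G X Y n (- p)"]) (auto simp: add_residue free_hom_neg)
  qed (auto simp: add_residue algebra_simps free_hom_add)
qed (auto simp: add_residue smult_residue free_hom_add free_hom_scal ring_of_type_algebra_def
    lc.scale_right_distrib lc.scale_left_distrib cring_from_type_algebra[unfolded ring_of_type_algebra_def])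

lemma klinear_induced:
  assumes T: "descends C G G' X Y n X' Y' n' T" and XY': "X' \<in> Obj C" "Y' \<in> Obj C"
  shows "klinear (adjoin_hom C G X Y n) (adjoin_hom C G' X' Y' n') (induced C G' X' Y' n' T)"
proof -
  have T': "lin T" "\<And>p. p \<in> free_hom C G X Y n \<Longrightarrow> T p \<in> free_hom C G' X' Y' n'"
    using T by (auto simp: descends_def)
  show ?thesis
    unfolding klinear_def
    by (auto simp: induced_residue[OF T] T' add_residue smult_residue linD[OF T'(1)]
        free_hom_add free_hom_scal dg_category.add_residue[OF dg_category_axioms XY']
        dg_category.smult_residue[OF dg_category_axioms XY'])
qed

end

lemma cmp_residue:
  assumes X: "X \<in> Obj C" and Y: "Y \<in> Obj C" and Z: "Z \<in> Obj C"
    and q: "q \<in> free_hom C G Y Z m" and p: "p \<in> free_hom C G X Y n"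
  shows "cmp (adjoin C G) X Y Z m n (residue C G Y Z m q) (residue C G X Y n p)
    = residue C G X Z (m + n) (wmul q p)"
proof -
  have "residue C G X Z (m + n) (wmul q' p') = residue C G X Z (m + n) (wmul q p)"
    if "q' \<in> residue C G Y Z m q" "p' \<in> residue C G X Y n p" for q' p'
  proof (rule residue_eqI)
    have "null C G X Z (m + n) (wmul (q' - q) p' + wmul q (p' - p))"
      using that q by (intro null_add null_wmul_left null_wmul_right X Z) (auto simp: residue_def)
    then show "null C G X Z (m + n) (wmul q' p' - wmul q p)" by simp
  qed (use p q that in \<open>auto simp: residue_def\<close>)
  then have "(\<Union>q'\<in>residue C G Y Z m q. \<Union>p'\<in>residue C G X Y n p. residue C G X Z (m + n) (wmul q' p'))
      = residue C G X Z (m + n) (wmul q p)"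
    using residue_self[OF X Y p] residue_self[OF Y Z q] by blast
  then show ?thesis by (simp add: adjoin_def)
qed

end

text \<open>
  The requirement on the generators for the Leibniz rule to define a differential.  The square of the
  differential has to vanish only modulo relations.
\<close>

locale generated_extension = dg_category C
  for C :: "('o, 'm, 'k::field) dgcat" +
  fixes G :: "('o, 'm, 'e, 'k) generators"
  assumes gdif_closed:
      "\<lbrakk>X \<in> Obj C; e \<in> gens G X\<rbrakk> \<Longrightarrow> gdif G X e \<in> free_hom C G X X (gdeg G e + 1)"
    and gdif_gdif:
      "\<lbrakk>X \<in> Obj C; e \<in> gens G X\<rbrakk> \<Longrightarrow>
        null C G X X (gdeg G e + 1 + 1) (lin_extend (word_dif C G) (gdif G X e))"
begin

abbreviation "D \<equiv> lin_extend (word_dif C G)"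

lemma letter_dif_free_hom:
  "is_word C G X Y [l] \<Longrightarrow> letter_dif C G l \<in> free_hom C G X Y (letter_deg G l + 1)"
  by (cases l) (auto intro: gdif_closed)

text \<open>
  The differential respects the relations because the differential of \<open>C\<close> is linear, satisfies the Leibniz
  rule and kills identities.
\<close>

lemma twisted_derivation_dif:
  "twisted_derivation C G (\<lambda>X e. wd [Eps X e]) (letter_dif C G) 1"
proof
  fix X Y n f g
  assume *: "X \<in> Obj C" "Y \<in> Obj C" "f \<in> carrier (Hom C X Y n)"
  have lin: "klinear (Hom C X Y n) (Hom C X Y (n + 1)) (dif C X Y n)" using * dif_linear by auto
  show "null C G X Y (n + 1) (letter_dif C G (Mor X Y n (c \<odot>\<^bsub>Hom C X Y n\<^esub> f))
      - scal c (letter_dif C G (Mor X Y n f)))" for c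
    using null_mor_smult[OF *(1,2) dif_closed[OF *]] lin * by (auto simp: klinear_def)
  assume g: "g \<in> carrier (Hom C X Y n)"
  show "null C G X Y (n + 1) (letter_dif C G (Mor X Y n (f \<oplus>\<^bsub>Hom C X Y n\<^esub> g))
      - (letter_dif C G (Mor X Y n f) + letter_dif C G (Mor X Y n g)))"
    using null_mor_add[OF *(1,2) dif_closed[OF *] dif_closed[OF *(1,2) g]] lin * g
    by (auto simp: klinear_def)
next
  fix X Y Z m g n f
  assume X: "X \<in> Obj C" and Y: "Y \<in> Obj C" and Z: "Z \<in> Obj C"
    and g: "g \<in> carrier (Hom C Y Z m)" and f: "f \<in> carrier (Hom C X Y n)"
  define a b where "a = cmp C X Y Z (m + 1) n (dif C Y Z m g) f"
    and "b = cmp C X Y Z m (n + 1) g (dif C X Y n f)"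
  let ?N = "m + n + 1" and ?M = "\<lambda>h. wd [Mor X Z (m + n + 1) h] :: ('o, 'm, 'e, 'k) lincomb"
  have a: "a \<in> carrier (Hom C X Z ?N)"
    using cmp_closed[OF X Y Z dif_closed[OF Y Z g] f] by (simp add: a_def algebra_simps)
  have b: "b \<in> carrier (Hom C X Z ?N)"
    using cmp_closed[OF X Y Z g dif_closed[OF X Y f]] by (simp add: b_def algebra_simps)
  let ?sb = "koszul m \<odot>\<^bsub>Hom C X Z ?N\<^esub> b"
  have sb: "?sb \<in> carrier (Hom C X Z ?N)" using b X Z by auto
  have n1: "null C G X Z ?N (wd [Mor Y Z (m + 1) (dif C Y Z m g), Mor X Y n f] - ?M a)"
    using null_mor_cmp[OF X Y Z dif_closed[OF Y Z g] f, of G] by (simp add: a_def algebra_simps)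
  have n2: "null C G X Z ?N
      (scal (koszul m) (wd [Mor Y Z m g, Mor X Y (n + 1) (dif C X Y n f)] - ?M b))"
    using null_mor_cmp[OF X Y Z g dif_closed[OF X Y f], of G]
    by (intro null_scal) (simp add: b_def algebra_simps)
  have n3: "null C G X Z ?N (?M (a \<oplus>\<^bsub>Hom C X Z ?N\<^esub> ?sb) - (?M a + ?M ?sb))"
    by (rule null_mor_add[OF X Z a sb])
  have n4: "null C G X Z ?N (?M ?sb - scal (koszul m) (?M b))"
    by (rule null_mor_smult[OF X Z b])
  from null_diff[OF null_diff[OF null_add[OF n1 n2] n3] n4] have "null C G X Z ?N
      (wd [Mor Y Z (m + 1) (dif C Y Z m g), Mor X Y n f]
      + scal (koszul m) (wd [Mor Y Z m g, Mor X Y (n + 1) (dif C X Y n f)])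
      - ?M (a \<oplus>\<^bsub>Hom C X Z ?N\<^esub> ?sb))"
    by (simp add: algebra_simps lc.scale_right_diff_distrib)
  then show "null C G X Z (m + n + 1)
      (wmul (letter_dif C G (Mor Y Z m g)) (wd [Mor X Y n f])
        + scal (koszul m) (wmul (wd [Mor Y Z m g]) (letter_dif C G (Mor X Y n f)))
        - letter_dif C G (Mor X Z (m + n) (cmp C X Y Z m n g f)))"
    by (simp add: leibniz[OF X Y Z g f] a_def b_def)
next
  fix X assume X: "X \<in> Obj C"
  then show "null C G X X 1 (letter_dif C G (Mor X X 0 (idt C X)))"
    using null_mor_zero[OF X X, of G 1] dif_idt[OF X] by simp
qed (auto intro: letter_dif_free_hom)

sublocale deriv: twisted_derivation C G "\<lambda>X e. wd [Eps X e]" "letter_dif C G" 1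
  rewrites "der (letter_deg G) (letter_subst (\<lambda>X e. wd [Eps X e])) (letter_dif C G) = word_dif C G"
  by (rule twisted_derivation_dif) (simp add: letter_subst_Eps word_dif_der)

lemmas dif_free_hom = deriv.deriv_free_hom
lemmas dif_null = deriv.deriv_null

lemma descends_dif:
  "descends C G G X Y n X Y (n + 1) D"
  by (auto simp: descends_def linear_lin_extend intro: dif_free_hom dif_null)

text \<open>
  The square of an odd derivation is a derivation, as the two mixed terms cancel.  On a letter from \<open>C\<close> it gives
  the letter of the zero morphism, which is zero only modulo relations.
\<close>

lemma dif_word_dif:
  "is_word C G X Y w \<Longrightarrow> null C G X Y (word_deg G w + 1 + 1) (D (word_dif C G w))"
proof (induction w arbitrary: Y)
  case Nil
  then show ?case by (auto intro: null_zero)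
next
  case (Cons l w)
  from Cons.prems obtain Z where l: "is_word C G Z Y [l]" and w: "is_word C G X Z w"
    by (subst (asm) is_word_Cons) auto
  note o = is_word_objs[OF l] is_word_objs[OF w]
  have "D (word_dif C G (l # w)) = wmul (D (letter_dif C G l)) (wd w)
      + scal (koszul (letter_deg G l + 1) + koszul (letter_deg G l))
          (wmul (letter_dif C G l) (word_dif C G w))
      + wmul (wd [l]) (D (word_dif C G w))"
    using l word_dif_wmul[OF letter_dif_free_hom[OF l], of C "wd w"]
      word_dif_wmul[of "wd [l]" C G Z Y "letter_deg G l" C "word_dif C G w"]
    by (simp add: lc.scale_right_distrib lc.scale_left_distrib koszul_simps algebra_simps)
  also have "koszul (letter_deg G l + 1) + koszul (letter_deg G l) = (0 :: 'k)"
    by (simp add: koszul_simps)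
  finally have eq: "D (word_dif C G (l # w)) =
      wmul (D (letter_dif C G l)) (wd w) + wmul (wd [l]) (D (word_dif C G w))" by simp
  have "null C G Z Y (letter_deg G l + 1 + 1) (D (letter_dif C G l))"
  proof (cases l)
    case (Mor A B n f)
    then show ?thesis using l null_mor_zero[of A B G "n + 1 + 1"] by (auto simp: dif_dif)
  next
    case (Eps A e)
    then show ?thesis using l gdif_gdif[of A e] by auto
  qed
  then have "null C G X Y (letter_deg G l + 1 + 1 + word_deg G w) (wmul (D (letter_dif C G l)) (wd w))"
    using w o by (intro null_wmul_right) auto
  moreover have "null C G X Y (letter_deg G l + (word_deg G w + 1 + 1)) (wmul (wd [l]) (D (word_dif C G w)))"
    using null_wmul_left[OF Cons.IH[OF w], of "wd [l]" Y "letter_deg G l"] l o by simp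
  ultimately show ?case unfolding eq by (intro null_add) (simp_all add: algebra_simps)
qed

lemma dif_dif_null:
  assumes "X \<in> Obj C" "Y \<in> Obj C" "p \<in> free_hom C G X Y n"
  shows "null C G X Y (n + 1 + 1) (D (D p))"
  by (rule null_lin[where T = "\<lambda>p. D (D p)", OF _ assms(3,1,2)])
    (auto intro!: lin_intros linear_lin_extend dest: dif_word_dif)

lemma dif_residue:
  assumes "X \<in> Obj C" "Y \<in> Obj C" "p \<in> free_hom C G X Y n"
  shows "dif (adjoin C G) X Y n (residue C G X Y n p) = residue C G X Y (n + 1) (D p)"
  using induced_residue[OF assms(1,2) descends_dif assms(3)] by simp

lemma dg_category_adjoin: "dg_category (adjoin C G)"
proof (rule dg_category.intro)
  fix X Y n
  assume X: "X \<in> Obj (adjoin C G)" and Y: "Y \<in> Obj (adjoin C G)"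
  have XY: "X \<in> Obj C" "Y \<in> Obj C" using X Y by auto
  show "module (ring_of_type_algebra :: 'k ring) (Hom (adjoin C G) X Y n)"
    by (simp add: module_adjoin_hom XY)
  show "klinear (Hom (adjoin C G) X Y n) (Hom (adjoin C G) X Y (n + 1)) (dif (adjoin C G) X Y n)"
    by (simp add: klinear_induced descends_dif XY)
  fix P assume "P \<in> carrier (Hom (adjoin C G) X Y n)"
  then obtain p where p: "p \<in> free_hom C G X Y n" "P = residue C G X Y n p" by auto
  show "dif (adjoin C G) X Y (n + 1) (dif (adjoin C G) X Y n P) = \<zero>\<^bsub>Hom (adjoin C G) X Y (n + 1 + 1)\<^esub>"
    using p XY residue_zero_iff[OF XY dif_free_hom[OF dif_free_hom[OF p(1)]]] dif_dif_null[OF XY p(1)]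
    by (simp add: dif_residue dif_free_hom del: adjoin_simps(3))
  show "cmp (adjoin C G) X Y Y 0 n (idt (adjoin C G) Y) P = P"
    using p XY cmp_residue[OF XY(1,2,2), of "wd []" G 0 p n] by simp
  show "cmp (adjoin C G) X X Y n 0 P (idt (adjoin C G) X) = P"
    using p XY cmp_residue[OF XY(1,1,2), of p G n "wd []" 0] by simp
next
  fix X Y Z P n m
  assume "X \<in> Obj (adjoin C G)" "Y \<in> Obj (adjoin C G)" "Z \<in> Obj (adjoin C G)"
    and "P \<in> carrier (Hom (adjoin C G) X Y n)"
  then obtain p where o: "X \<in> Obj C" "Y \<in> Obj C" "Z \<in> Obj C"
    and p: "p \<in> free_hom C G X Y n" "P = residue C G X Y n p" by auto
  then show "klinear (Hom (adjoin C G) Y Z m) (Hom (adjoin C G) X Z (m + n))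
      (\<lambda>Q. cmp (adjoin C G) X Y Z m n Q P)"
    by (auto simp: klinear_def cmp_residue add_residue smult_residue free_hom_wmul free_hom_add free_hom_scal)
next
  fix X Y Z P n m
  assume "X \<in> Obj (adjoin C G)" "Y \<in> Obj (adjoin C G)" "Z \<in> Obj (adjoin C G)"
    and "P \<in> carrier (Hom (adjoin C G) Y Z m)"
  then obtain p where o: "X \<in> Obj C" "Y \<in> Obj C" "Z \<in> Obj C"
    and p: "p \<in> free_hom C G Y Z m" "P = residue C G Y Z m p" by auto
  then show "klinear (Hom (adjoin C G) X Y n) (Hom (adjoin C G) X Z (m + n))
      (\<lambda>Q. cmp (adjoin C G) X Y Z m n P Q)"
    by (auto simp: klinear_def cmp_residue add_residue smult_residue free_hom_wmul free_hom_add free_hom_scal)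
next
  fix W X Y Z R l Q m P n
  assume "W \<in> Obj (adjoin C G)" "X \<in> Obj (adjoin C G)" "Y \<in> Obj (adjoin C G)" "Z \<in> Obj (adjoin C G)"
    and "R \<in> carrier (Hom (adjoin C G) Y Z l)" "Q \<in> carrier (Hom (adjoin C G) X Y m)"
      "P \<in> carrier (Hom (adjoin C G) W X n)"
  then obtain r q p where o: "W \<in> Obj C" "X \<in> Obj C" "Y \<in> Obj C" "Z \<in> Obj C"
    and "r \<in> free_hom C G Y Z l" "R = residue C G Y Z l r"
      "q \<in> free_hom C G X Y m" "Q = residue C G X Y m q"
      "p \<in> free_hom C G W X n" "P = residue C G W X n p" by auto
  then show "cmp (adjoin C G) W X Z (l + m) n (cmp (adjoin C G) X Y Z l m R Q) P =
      cmp (adjoin C G) W Y Z l (m + n) R (cmp (adjoin C G) W X Y m n Q P)"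
    by (simp add: cmp_residue free_hom_wmul wmul_assoc add.assoc)
next
  fix X Y Z Q m P n
  assume "X \<in> Obj (adjoin C G)" "Y \<in> Obj (adjoin C G)" "Z \<in> Obj (adjoin C G)"
    and "Q \<in> carrier (Hom (adjoin C G) Y Z m)" "P \<in> carrier (Hom (adjoin C G) X Y n)"
  then obtain q p where o: "X \<in> Obj C" "Y \<in> Obj C" "Z \<in> Obj C"
    and q: "q \<in> free_hom C G Y Z m" and Q: "Q = residue C G Y Z m q"
    and p: "p \<in> free_hom C G X Y n" and P: "P = residue C G X Y n p" by auto
  have 1: "cmp (adjoin C G) X Y Z (m + 1) n (dif (adjoin C G) Y Z m Q) P
      = residue C G X Z (m + n + 1) (wmul (D q) p)"
    using cmp_residue[OF o dif_free_hom[OF q] p] o q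
    by (simp add: Q P dif_residue ac_simps del: adjoin_simps(3))
  have 2: "cmp (adjoin C G) X Y Z m (n + 1) Q (dif (adjoin C G) X Y n P)
      = residue C G X Z (m + n + 1) (wmul q (D p))"
    using cmp_residue[OF o q dif_free_hom[OF p]] o p
    by (simp add: Q P dif_residue ac_simps del: adjoin_simps(3))
  have f1: "wmul (D q) p \<in> free_hom C G X Z (m + n + 1)"
    using free_hom_wmul[OF dif_free_hom[OF q] p] by (simp add: algebra_simps)
  have f2: "wmul q (D p) \<in> free_hom C G X Z (m + n + 1)"
    using free_hom_wmul[OF q dif_free_hom[OF p]] by (simp add: algebra_simps)
  show "dif (adjoin C G) X Z (m + n) (cmp (adjoin C G) X Y Z m n Q P) =
      cmp (adjoin C G) X Y Z (m + 1) n (dif (adjoin C G) Y Z m Q) P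
      \<oplus>\<^bsub>Hom (adjoin C G) X Z (m + n + 1)\<^esub>
      koszul m \<odot>\<^bsub>Hom (adjoin C G) X Z (m + n + 1)\<^esub>
        cmp (adjoin C G) X Y Z m (n + 1) Q (dif (adjoin C G) X Y n P)"
    unfolding 1 2 using o q p f1 f2
    by (simp add: Q P cmp_residue dif_residue free_hom_wmul smult_residue add_residue free_hom_scal
        word_dif_wmul[OF q] del: adjoin_simps(3))
qed auto

end

section \<open>Dg functors given by substitutions\<close>

text \<open>
  A substitution commutes with the differentials as soon as it does so on the adjoined generators.
\<close>

locale dg_substitution = substitution C G G' \<tau> +
    src: generated_extension C G + tgt: generated_extension C G'
  for C :: "('o, 'm, 'k::field) dgcat"
    and G :: "('o, 'm, 'e, 'k) generators" and G' :: "('o, 'm, 'f, 'k) generators" and \<tau> +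
  assumes subst_gdif:
    "\<lbrakk>X \<in> Obj C; e \<in> gens G X\<rbrakk> \<Longrightarrow> subst \<tau> (gdif G X e) = lin_extend (word_dif C G') (\<tau> X e)"
begin

lemma sub_word_dif:
  "is_word C G X Y w \<Longrightarrow> subst \<tau> (word_dif C G w) = tgt.D (sub (letter_subst \<tau>) w)"
proof (induction w arbitrary: Y)
  case (Cons l w)
  from Cons.prems obtain Z where l: "is_word C G Z Y [l]" and w: "is_word C G X Z w"
    by (subst (asm) is_word_Cons) auto
  have "subst \<tau> (letter_dif C G l) = tgt.D (letter_subst \<tau> l)"
    using l by (cases l) (auto simp: subst_gdif)
  then show ?case
    by (simp add: sub_wmul word_dif_wmul[OF letter_subst_free_hom[OF l]] Cons.IH[OF w])
qed simp

lemma subst_dif: "p \<in> free_hom C G X Y n \<Longrightarrow> subst \<tau> (src.D p) = tgt.D (subst \<tau> p)"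
  by (erule lin_eqI_free_hom[rotated 2, where S = "\<lambda>p. subst \<tau> (src.D p)" and T = "\<lambda>p. tgt.D (subst \<tau> p)"])
    (auto intro!: lin_intros linear_lin_extend sub_word_dif)

definition "subst_functor =
  \<lparr>fobj = (\<lambda>X. X), fmor = (\<lambda>X Y n. induced C G' X Y n (subst \<tau>))\<rparr>"

lemma descends_subst: "descends C G G' X Y n X Y n (subst \<tau>)"
  by (auto simp: descends_def linear_lin_extend intro: subst_free_hom subst_null)

lemma subst_functor_residue:
  assumes "X \<in> Obj C" "Y \<in> Obj C" "p \<in> free_hom C G X Y n"
  shows "fmor subst_functor X Y n (residue C G X Y n p) = residue C G' X Y n (subst \<tau> p)"
  using induced_residue[OF assms(1,2) descends_subst assms(3)] by (simp add: subst_functor_def)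

lemma dg_functor_subst: "dg_functor (adjoin C G) (adjoin C G') subst_functor"
proof -
  interpret A: dg_category "adjoin C G" by (rule src.dg_category_adjoin)
  interpret B: dg_category "adjoin C G'" by (rule tgt.dg_category_adjoin)
  have F: "fobj subst_functor X = X" for X by (simp add: subst_functor_def)
  show ?thesis
  proof
    fix X Y n
    assume "X \<in> Obj (adjoin C G)" "Y \<in> Obj (adjoin C G)"
    then have o: "X \<in> Obj C" "Y \<in> Obj C" by auto
    show "klinear (Hom (adjoin C G) X Y n) (Hom (adjoin C G') (fobj subst_functor X) (fobj subst_functor Y) n)
        (fmor subst_functor X Y n)"
      by (simp add: subst_functor_def klinear_induced o descends_subst)
    fix P assume "P \<in> carrier (Hom (adjoin C G) X Y n)"
    then obtain p where p: "p \<in> free_hom C G X Y n" "P = residue C G X Y n p" by auto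
    show "fmor subst_functor X Y (n + 1) (dif (adjoin C G) X Y n P) =
        dif (adjoin C G') (fobj subst_functor X) (fobj subst_functor Y) n (fmor subst_functor X Y n P)"
      using p o by (simp add: F src.dif_residue tgt.dif_residue subst_functor_residue src.dif_free_hom
          subst_free_hom subst_dif del: adjoin_simps(3))
  next
    fix X Y Z Q m P n
    assume "X \<in> Obj (adjoin C G)" "Y \<in> Obj (adjoin C G)" "Z \<in> Obj (adjoin C G)"
      and "Q \<in> carrier (Hom (adjoin C G) Y Z m)" "P \<in> carrier (Hom (adjoin C G) X Y n)"
    then obtain q p where "X \<in> Obj C" "Y \<in> Obj C" "Z \<in> Obj C"
      "q \<in> free_hom C G Y Z m" "Q = residue C G Y Z m q"
      "p \<in> free_hom C G X Y n" "P = residue C G X Y n p" by auto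
    then show "fmor subst_functor X Z (m + n) (cmp (adjoin C G) X Y Z m n Q P) =
        cmp (adjoin C G') (fobj subst_functor X) (fobj subst_functor Y) (fobj subst_functor Z) m n
          (fmor subst_functor Y Z m Q) (fmor subst_functor X Y n P)"
      by (simp add: F cmp_residue subst_functor_residue free_hom_wmul subst_free_hom sub_wmul)
  qed (auto simp: F subst_functor_residue)
qed

end

text \<open>
  Every residue class is a linear combination of composites of classes of single letters, and a dg
  functor preserves linear combinations and composites.
\<close>

lemma (in generated_extension) functors_agree:
  assumes F: "dg_functor (adjoin C G) B F" and F': "dg_functor (adjoin C G) B F'"
    and obj: "\<And>X. X \<in> Obj C \<Longrightarrow> fobj F X = fobj F' X"
    and mor: "\<And>X Y n f. \<lbrakk>X \<in> Obj C; Y \<in> Obj C; f \<in> carrier (Hom C X Y n)\<rbrakk> \<Longrightarrow>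
      fmor F X Y n (adjoin_mor C G X Y n f) = fmor F' X Y n (adjoin_mor C G X Y n f)"
    and eps: "\<And>X e. \<lbrakk>X \<in> Obj C; e \<in> gens G X\<rbrakk> \<Longrightarrow>
      fmor F X X (gdeg G e) (adjoin_eps C G X e) = fmor F' X X (gdeg G e) (adjoin_eps C G X e)"
    and o: "X \<in> Obj C" "Y \<in> Obj C" and P: "P \<in> carrier (Hom (adjoin C G) X Y n)"
  shows "fmor F X Y n P = fmor F' X Y n P"
proof -
  interpret F: dg_functor "adjoin C G" B F by (rule F)
  interpret F': dg_functor "adjoin C G" B F' by (rule F')
  have word: "fmor F X Y (word_deg G w) (residue C G X Y (word_deg G w) (wd w)) =
      fmor F' X Y (word_deg G w) (residue C G X Y (word_deg G w) (wd w))"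
    if "is_word C G X Y w" for w X Y
    using that
  proof (induction w arbitrary: Y)
    case Nil
    then show ?case using F.fmor_idt[of X] F'.fmor_idt[of X] obj[of X] by auto
  next
    case (Cons l w)
    from Cons.prems obtain Z where l: "is_word C G Z Y [l]" and w: "is_word C G X Z w"
      by (subst (asm) is_word_Cons) auto
    note o = is_word_objs[OF l] is_word_objs[OF w]
    let ?l = "residue C G Z Y (letter_deg G l) (wd [l])"
    let ?w = "residue C G X Z (word_deg G w) (wd w)"
    have m: "?l \<in> carrier (Hom (adjoin C G) Z Y (letter_deg G l))"
      "?w \<in> carrier (Hom (adjoin C G) X Z (word_deg G w))"
      using l w by auto
    have split: "residue C G X Y (word_deg G (l # w)) (wd (l # w)) =
        cmp (adjoin C G) X Z Y (letter_deg G l) (word_deg G w) ?l ?w"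
      using cmp_residue[of X Z Y "wd [l]" G "letter_deg G l" "wd w" "word_deg G w"] o l w by simp
    have letter: "fmor F Z Y (letter_deg G l) ?l = fmor F' Z Y (letter_deg G l) ?l"
      using l mor eps by (cases l) (auto simp: adjoin_mor_def adjoin_eps_def)
    show ?case
      unfolding split unfolding word_deg_simps
      using F.fmor_cmp[OF _ _ _ m] F'.fmor_cmp[OF _ _ _ m] o obj letter Cons.IH[OF w] by simp
  qed
  obtain p where p: "p \<in> free_hom C G X Y n" "P = residue C G X Y n p" using P by auto
  have "fmor F X Y n (residue C G X Y n (\<Sum>w\<in>A. scal (c w) (wd w))) =
      fmor F' X Y n (residue C G X Y n (\<Sum>w\<in>A. scal (c w) (wd w)))"
    if "finite A" "\<And>w. w \<in> A \<Longrightarrow> is_word C G X Y w \<and> word_deg G w = n" for A c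
    using that
  proof (induction A)
    case empty
    let ?z = "residue C G X Y n 0"
    have z: "0 \<odot>\<^bsub>Hom (adjoin C G) X Y n\<^esub> ?z = ?z" using smult_residue[OF o, of 0 G n 0] by simp
    have m: "?z \<in> carrier (Hom (adjoin C G) X Y n)" by auto
    have "fmor F X Y n (0 \<odot>\<^bsub>Hom (adjoin C G) X Y n\<^esub> ?z) = \<zero>\<^bsub>Hom B (fobj F X) (fobj F Y) n\<^esub>"
      using F.fmor_linear[of X Y n] m o F.fobj_closed
      by (auto simp: klinear_def F.B.smult_zero_hom Pi_iff simp del: adjoin_simps(2))
    moreover have "fmor F' X Y n (0 \<odot>\<^bsub>Hom (adjoin C G) X Y n\<^esub> ?z) = \<zero>\<^bsub>Hom B (fobj F' X) (fobj F' Y) n\<^esub>"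
      using F'.fmor_linear[of X Y n] m o F'.fobj_closed
      by (auto simp: klinear_def F.B.smult_zero_hom Pi_iff simp del: adjoin_simps(2))
    ultimately show ?case using z obj o by simp
  next
    case (insert w A)
    let ?r = "\<Sum>w\<in>A. scal (c w) (wd w)" and ?H = "Hom (adjoin C G) X Y n"
    have w: "wd w \<in> free_hom C G X Y n" using insert.prems by auto
    have r: "?r \<in> free_hom C G X Y n"
      by (intro free_hom_sum free_hom_scal) (use insert.prems in auto)
    have m: "residue C G X Y n (wd w) \<in> carrier ?H" "residue C G X Y n ?r \<in> carrier ?H"
      using w r by auto
    have m': "c w \<odot>\<^bsub>?H\<^esub> residue C G X Y n (wd w) \<in> carrier ?H"
      using w by (simp add: smult_residue o free_hom_scal del: free_hom_wd)
    have split: "residue C G X Y n (\<Sum>w\<in>insert w A. scal (c w) (wd w)) =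
        c w \<odot>\<^bsub>?H\<^esub> residue C G X Y n (wd w) \<oplus>\<^bsub>?H\<^esub> residue C G X Y n ?r"
      using insert.hyps w r by (simp add: add_residue smult_residue free_hom_scal o)
    have "fmor F X Y n (residue C G X Y n ?r) = fmor F' X Y n (residue C G X Y n ?r)"
      by (intro insert.IH insert.prems) auto
    moreover have "fmor F X Y n (residue C G X Y n (wd w)) = fmor F' X Y n (residue C G X Y n (wd w))"
      using word[of X Y w] insert.prems[of w] by auto
    ultimately show ?case
      unfolding split using F.fmor_linear[of X Y n] F'.fmor_linear[of X Y n] m m' o obj
      by (simp add: klinear_def del: adjoin_simps(2))
  qed
  from this[of "Poly_Mapping.keys p" "Poly_Mapping.lookup p"] p show ?thesis
    by (simp add: free_hom_def flip: lin_extend_def lincomb_expand)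
qed

section \<open>A criterion for quasi-equivalences\<close>

context dg_category
begin

lemma abelian_group_hom:
  "\<lbrakk>X \<in> Obj C; Y \<in> Obj C\<rbrakk> \<Longrightarrow> abelian_group (Hom C X Y n)"
  using hom_module[of X Y n] by (simp add: Module.module_def)

lemma minus_hom:
  assumes "X \<in> Obj C" "Y \<in> Obj C" "f \<in> carrier (Hom C X Y n)"
  shows "\<ominus>\<^bsub>Hom C X Y n\<^esub> f = (- 1) \<odot>\<^bsub>Hom C X Y n\<^esub> f"
proof -
  interpret Module.module "ring_of_type_algebra :: 'k ring" "Hom C X Y n"
    by (rule hom_module) fact+
  have "(- 1) \<odot>\<^bsub>Hom C X Y n\<^esub> f \<oplus>\<^bsub>Hom C X Y n\<^esub> 1 \<odot>\<^bsub>Hom C X Y n\<^esub> f = 0 \<odot>\<^bsub>Hom C X Y n\<^esub> f"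
    using smult_l_distr[of "- 1" 1 f] assms(3) by (simp add: ring_of_type_algebra_def)
  then show ?thesis
    using smult_one[OF assms(3)] smult_zero_hom[OF assms] assms
    by (intro M.minus_equality) (auto simp: ring_of_type_algebra_def intro: hom_smult)
qed

lemma klinear_zero:
  assumes "klinear (Hom C X Y n) N f" "X \<in> Obj C" "Y \<in> Obj C"
  shows "f \<zero>\<^bsub>Hom C X Y n\<^esub> = 0 \<odot>\<^bsub>N\<^esub> f \<zero>\<^bsub>Hom C X Y n\<^esub>"
  using assms hom_zero[of X Y n] smult_zero_hom[of X Y "\<zero>\<^bsub>Hom C X Y n\<^esub>" n]
  by (auto simp: klinear_def) metis

lemma cocyclesD: "f \<in> cocycles C X Y n \<Longrightarrow> f \<in> carrier (Hom C X Y n)"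
  by (simp add: cocycles_def)

context
  fixes X Y :: 'o and n :: int
  assumes XY: "X \<in> Obj C" "Y \<in> Obj C"
begin

lemma cocycles_add:
  "f \<in> cocycles C X Y n \<Longrightarrow> g \<in> cocycles C X Y n \<Longrightarrow> f \<oplus>\<^bsub>Hom C X Y n\<^esub> g \<in> cocycles C X Y n"
  using dif_linear[OF XY, of n] abelian_group.axioms(1)[OF abelian_group_hom[OF XY, of "n + 1"]] hom_zero[OF XY, of "n + 1"]
  by (auto simp: cocycles_def klinear_def hom_add[OF XY] abelian_monoid.l_zero)

lemma cocycles_smult: "f \<in> cocycles C X Y n \<Longrightarrow> c \<odot>\<^bsub>Hom C X Y n\<^esub> f \<in> cocycles C X Y n"
  using dif_linear[OF XY, of n] hom_module[OF XY, of "n + 1"]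
  by (auto simp: cocycles_def klinear_def hom_smult[OF XY] ring_of_type_algebra_def
      intro: Module.module.smult_r_null)

lemma abelian_subgroup_coboundaries: "abelian_subgroup (coboundaries C X Y n) (Hom C X Y n)"
proof (rule abelian_subgroupI3[OF additive_subgroupI])
  let ?d = "dif C X Y (n - 1)"
  interpret A: abelian_group "Hom C X Y (n - 1)" by (rule abelian_group_hom[OF XY])
  interpret B: abelian_group "Hom C X Y n" by (rule abelian_group_hom[OF XY])
  have "klinear (Hom C X Y (n - 1)) (Hom C X Y n) ?d" using dif_linear[OF XY, of "n - 1"] by simp
  then have "?d \<in> hom (add_monoid (Hom C X Y (n - 1))) (add_monoid (Hom C X Y n))"
    by (auto simp: klinear_def hom_def)
  then have "group_hom (add_monoid (Hom C X Y (n - 1))) (add_monoid (Hom C X Y n)) ?d"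
    by (intro group_hom.intro group_hom_axioms.intro A.a_group B.a_group)
  from group_hom.img_is_subgroup[OF this]
  show "subgroup (coboundaries C X Y n) (add_monoid (Hom C X Y n))"
    by (simp add: coboundaries_def)
qed (rule abelian_group_hom[OF XY])

interpretation bd: abelian_subgroup "coboundaries C X Y n" "Hom C X Y n"
  by (rule abelian_subgroup_coboundaries)

text \<open>
  The difference is written with the scalar \<open>- 1\<close>, so that linear maps visibly commute with it.
\<close>

lemma coh_class_eq_iff:
  assumes f: "f \<in> carrier (Hom C X Y n)" and g: "g \<in> carrier (Hom C X Y n)"
  shows "coh_class C X Y n f = coh_class C X Y n g \<longleftrightarrow>
    f \<oplus>\<^bsub>Hom C X Y n\<^esub> ((- 1) \<odot>\<^bsub>Hom C X Y n\<^esub> g) \<in> coboundaries C X Y n"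
proof -
  have "f \<in> coh_class C X Y n g \<longleftrightarrow> coh_class C X Y n f = coh_class C X Y n g"
    using bd.a_rcos_self[OF f] bd.a_repr_independence[OF _ g bd.a_subgroup, of f]
    by (auto simp: coh_class_def)
  then show ?thesis
    using bd.a_rcos_module[OF g f] by (simp add: coh_class_def minus_hom[OF XY g])
qed

lemma coh_class_add:
  "\<lbrakk>f \<in> carrier (Hom C X Y n); g \<in> carrier (Hom C X Y n)\<rbrakk> \<Longrightarrow>
    coh_class C X Y n f <+>\<^bsub>Hom C X Y n\<^esub> coh_class C X Y n g
    = coh_class C X Y n (f \<oplus>\<^bsub>Hom C X Y n\<^esub> g)"
  unfolding coh_class_def by (rule bd.a_rcos_sum)

lemma mem_coh_class:
  assumes f: "f \<in> carrier (Hom C X Y n)"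
  shows "g \<in> coh_class C X Y n f \<longleftrightarrow>
    g \<in> carrier (Hom C X Y n) \<and> coh_class C X Y n g = coh_class C X Y n f"
  using bd.a_rcos_self bd.a_repr_independence[OF _ f bd.a_subgroup, of g]
    bd.a_r_coset_subset_G[OF bd.a_subset f] by (auto simp: coh_class_def)

lemma carrier_cohomology: "carrier (cohomology C X Y n) = coh_class C X Y n ` cocycles C X Y n"
  by (auto simp: cohomology_def A_FactGroup_def FactGroup_def RCOSETS_def coh_class_def
      a_r_coset_def r_coset_def)

lemma mult_cohomology: "monoid.mult (cohomology C X Y n) = set_add (Hom C X Y n)"
  by (auto simp: cohomology_def A_FactGroup_def FactGroup_def set_add_def set_mult_def fun_eq_iff)

end

lemma H0_isomorphic_refl:
  assumes X: "X \<in> Obj C"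
  shows "H0_isomorphic C X X"
  unfolding H0_isomorphic_def using dif_idt[OF X] idt_closed[OF X] idt_left[OF X X idt_closed[OF X]]
  by (intro bexI[of _ "idt C X"]) (auto simp: cocycles_def)

end

context dg_functor
begin

lemma fmor_cocycles:
  assumes "X \<in> Obj A" "Y \<in> Obj A" "f \<in> cocycles A X Y n"
  shows "fmor F X Y n f \<in> cocycles B (fobj F X) (fobj F Y) n"
proof -
  note o = fobj_closed[OF assms(1)] fobj_closed[OF assms(2)]
  have f: "f \<in> carrier (Hom A X Y n)" "dif A X Y n f = \<zero>\<^bsub>Hom A X Y (n + 1)\<^esub>"
    using assms(3) by (auto simp: cocycles_def)
  have *: "\<And>n g. g \<in> carrier (Hom A X Y n) \<Longrightarrow> fmor F X Y n g \<in> carrier (Hom B (fobj F X) (fobj F Y) n)"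
    using fmor_linear[OF assms(1,2)] unfolding klinear_def by blast
  have "fmor F X Y (n + 1) \<zero>\<^bsub>Hom A X Y (n + 1)\<^esub> = \<zero>\<^bsub>Hom B (fobj F X) (fobj F Y) (n + 1)\<^esub>"
    using A.klinear_zero[OF fmor_linear[OF assms(1,2)] assms(1,2), of "n + 1"]
      B.smult_zero_hom[OF o *[OF A.hom_zero[OF assms(1,2)]]] by simp
  then show ?thesis
    using f fmor_dif[OF assms(1,2) f(1)] * by (simp add: cocycles_def)
qed

lemma fmor_coboundaries:
  assumes "X \<in> Obj A" "Y \<in> Obj A" "f \<in> coboundaries A X Y n"
  shows "fmor F X Y n f \<in> coboundaries B (fobj F X) (fobj F Y) n"
proof -
  obtain g where "g \<in> carrier (Hom A X Y (n - 1))" "f = dif A X Y (n - 1) g"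
    using assms(3) by (auto simp: coboundaries_def)
  then show ?thesis
    using fmor_dif[OF assms(1,2), of g "n - 1"] fmor_linear[OF assms(1,2), of "n - 1"]
    by (auto simp: coboundaries_def klinear_def)
qed

text \<open>
  A homomorphism with zero kernel is injective, so \<open>inj\<close> may be stated for single cocycles.  As \<open>F\<close> is
  surjective on objects, essential surjectivity on \<open>H\<^sup>0\<close> is witnessed by identities.
\<close>

lemma quasi_equivalenceI:
  assumes inj: "\<And>X Y n f. \<lbrakk>X \<in> Obj A; Y \<in> Obj A; f \<in> cocycles A X Y n;
        fmor F X Y n f \<in> coboundaries B (fobj F X) (fobj F Y) n\<rbrakk> \<Longrightarrow> f \<in> coboundaries A X Y n"
    and surj: "\<And>X Y n g. \<lbrakk>X \<in> Obj A; Y \<in> Obj A; g \<in> cocycles B (fobj F X) (fobj F Y) n\<rbrakk> \<Longrightarrow>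
        \<exists>f\<in>cocycles A X Y n. fmor F X Y n f = g"
    and objs: "fobj F ` Obj A = Obj B"
  shows "quasi_equivalence A B F"
  unfolding quasi_equivalence_def
proof (intro conjI ballI allI)
  show "dg_functor A B F" by (rule dg_functor_axioms)
next
  fix Y assume "Y \<in> Obj B"
  then have "Y \<in> fobj F ` Obj A" unfolding objs .
  then obtain X where "X \<in> Obj A" "fobj F X = Y" by (elim imageE) simp
  then show "\<exists>X\<in>Obj A. H0_isomorphic B (fobj F X) Y"
    using B.H0_isomorphic_refl[of Y] \<open>Y \<in> Obj B\<close> by auto
next
  fix X Y n assume X: "X \<in> Obj A" and Y: "Y \<in> Obj A"
  note o = fobj_closed[OF X] fobj_closed[OF Y]
  let ?FX = "fobj F X" and ?FY = "fobj F Y"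
  let ?a = "coh_class A X Y n" and ?b = "coh_class B ?FX ?FY n"
  let ?M = "Hom A X Y n" and ?N = "Hom B ?FX ?FY n" and ?f = "fmor F X Y n"
  have lin: "klinear ?M ?N ?f" by (rule fmor_linear[OF X Y])
  have closed: "g \<in> carrier ?M \<Longrightarrow> ?f g \<in> carrier ?N" for g using lin by (auto simp: klinear_def)
  have diff: "?f (g \<oplus>\<^bsub>?M\<^esub> ((- 1) \<odot>\<^bsub>?M\<^esub> h)) = ?f g \<oplus>\<^bsub>?N\<^esub> ((- 1) \<odot>\<^bsub>?N\<^esub> ?f h)"
    if "g \<in> carrier ?M" "h \<in> carrier ?M" for g h
    using lin that A.hom_smult[OF X Y] by (simp add: klinear_def)
  have eq_iff: "?a g = ?a h \<longleftrightarrow> ?b (?f g) = ?b (?f h)"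
    if g: "g \<in> cocycles A X Y n" and h: "h \<in> cocycles A X Y n" for g h
  proof -
    note gh = A.cocyclesD[OF g] A.cocyclesD[OF h]
    have "g \<oplus>\<^bsub>?M\<^esub> ((- 1) \<odot>\<^bsub>?M\<^esub> h) \<in> cocycles A X Y n"
      by (intro A.cocycles_add A.cocycles_smult X Y g h)
    then show ?thesis
      unfolding A.coh_class_eq_iff[OF X Y gh] B.coh_class_eq_iff[OF o closed[OF gh(1)] closed[OF gh(2)]]
        diff[OF gh, symmetric]
      using inj[OF X Y] fmor_coboundaries[OF X Y] by blast
  qed
  have map: "coh_map B F X Y n (?a g) = ?b (?f g)" if g: "g \<in> cocycles A X Y n" for g
  proof -
    have "?b (?f h) = ?b (?f g)" if "h \<in> ?a g" for h
    proof -
      have h: "h \<in> carrier ?M" "?a h = ?a g"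
        using that A.mem_coh_class[OF X Y A.cocyclesD[OF g]] by auto
      then have "h \<oplus>\<^bsub>?M\<^esub> ((- 1) \<odot>\<^bsub>?M\<^esub> g) \<in> coboundaries A X Y n"
        using A.coh_class_eq_iff[OF X Y h(1) A.cocyclesD[OF g]] by simp
      from fmor_coboundaries[OF X Y this] show ?thesis
        unfolding diff[OF h(1) A.cocyclesD[OF g]]
        using B.coh_class_eq_iff[OF o closed[OF h(1)] closed[OF A.cocyclesD[OF g]]] by simp
    qed
    moreover have "g \<in> ?a g" using A.mem_coh_class[OF X Y A.cocyclesD[OF g]] A.cocyclesD[OF g] by simp
    ultimately show ?thesis unfolding coh_map_def by blast
  qed
  have "coh_map B F X Y n \<in> hom (cohomology A X Y n) (cohomology B ?FX ?FY n)"
  proof (rule homI)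
    fix K assume "K \<in> carrier (cohomology A X Y n)"
    then show "coh_map B F X Y n K \<in> carrier (cohomology B ?FX ?FY n)"
      using fmor_cocycles[OF X Y] by (auto simp: A.carrier_cohomology X Y B.carrier_cohomology o map)
  next
    fix K L assume "K \<in> carrier (cohomology A X Y n)" "L \<in> carrier (cohomology A X Y n)"
    then obtain g h where g: "g \<in> cocycles A X Y n" "K = ?a g" and h: "h \<in> cocycles A X Y n" "L = ?a h"
      by (auto simp: A.carrier_cohomology X Y)
    note gh = A.cocyclesD[OF g(1)] A.cocyclesD[OF h(1)]
    have "?f (g \<oplus>\<^bsub>?M\<^esub> h) = ?f g \<oplus>\<^bsub>?N\<^esub> ?f h" using lin gh by (simp add: klinear_def)
    then show "coh_map B F X Y n (K \<otimes>\<^bsub>cohomology A X Y n\<^esub> L) =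
        coh_map B F X Y n K \<otimes>\<^bsub>cohomology B ?FX ?FY n\<^esub> coh_map B F X Y n L"
      using g h by (simp add: A.mult_cohomology X Y B.mult_cohomology o A.coh_class_add[OF X Y gh] map
          A.cocycles_add B.coh_class_add[OF o closed[OF gh(1)] closed[OF gh(2)]])
  qed
  moreover have "bij_betw (coh_map B F X Y n) (carrier (cohomology A X Y n)) (carrier (cohomology B ?FX ?FY n))"
    unfolding bij_betw_def
  proof
    show "inj_on (coh_map B F X Y n) (carrier (cohomology A X Y n))"
    proof (rule inj_onI)
      fix K L assume "K \<in> carrier (cohomology A X Y n)" "L \<in> carrier (cohomology A X Y n)"
        and eq: "coh_map B F X Y n K = coh_map B F X Y n L"
      then obtain g h where g: "g \<in> cocycles A X Y n" "K = ?a g" and h: "h \<in> cocycles A X Y n" "L = ?a h"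
        by (auto simp: A.carrier_cohomology X Y)
      then show "K = L" using eq eq_iff[OF g(1) h(1)] by (simp only: map)
    qed
    show "coh_map B F X Y n ` carrier (cohomology A X Y n) = carrier (cohomology B ?FX ?FY n)"
    proof (intro equalityI subsetI)
      fix L assume "L \<in> carrier (cohomology B ?FX ?FY n)"
      then obtain h where h: "h \<in> cocycles B ?FX ?FY n" "L = ?b h" by (auto simp: B.carrier_cohomology o)
      then obtain g where "g \<in> cocycles A X Y n" "?f g = h" using surj[OF X Y] by auto
      then show "L \<in> coh_map B F X Y n ` carrier (cohomology A X Y n)"
        using h by (auto simp: A.carrier_cohomology X Y map intro!: image_eqI)
    qed (use fmor_cocycles[OF X Y] in \<open>auto simp: A.carrier_cohomology X Y B.carrier_cohomology o map\<close>)
  qed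
  ultimately show "coh_map B F X Y n \<in> Group.iso (cohomology A X Y n) (cohomology B ?FX ?FY n)"
    by (simp add: Group.iso_def)
qed

end

section \<open>Homotopies between a substitution and the identity\<close>

fun letter_htp ::
  "('o \<Rightarrow> 'e \<Rightarrow> ('o, 'm, 'e, 'k) lincomb) \<Rightarrow> ('o, 'm, 'e) letter \<Rightarrow> ('o, 'm, 'e, 'k::field) lincomb"
where
  "letter_htp \<kappa> (Mor A B n f) = 0"
| "letter_htp \<kappa> (Eps A e) = \<kappa> A e"

text \<open>
  The values \<open>\<kappa>\<close> of the homotopy on the adjoined generators; on morphisms of \<open>C\<close>, which the substitution
  fixes, the homotopy is zero.
\<close>

locale subst_homotopy = dg_substitution C G G \<tau>
  for C :: "('o, 'm, 'k::field) dgcat" and G :: "('o, 'm, 'e, 'k) generators" and \<tau> +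
  fixes \<kappa> :: "'o \<Rightarrow> 'e \<Rightarrow> ('o, 'm, 'e, 'k) lincomb"
  assumes htp_closed:
      "\<lbrakk>X \<in> Obj C; e \<in> gens G X\<rbrakk> \<Longrightarrow> \<kappa> X e \<in> free_hom C G X X (gdeg G e - 1)"
    and htp_gen:
      "\<lbrakk>X \<in> Obj C; e \<in> gens G X\<rbrakk> \<Longrightarrow>
        lin_extend (word_dif C G) (\<kappa> X e)
        + lin_extend (der (letter_deg G) (letter_subst \<tau>) (letter_htp \<kappa>)) (gdif G X e)
        = wd [Eps X e] - \<tau> X e"
begin

sublocale htp: twisted_derivation C G \<tau> "letter_htp \<kappa>" "- 1"
proof
  fix X Y and l :: "('o, 'm, 'e) letter"
  assume "is_word C G X Y [l]"
  then show "letter_htp \<kappa> l \<in> free_hom C G X Y (letter_deg G l + - 1)"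
    using htp_closed by (cases l) auto
qed (auto intro: null_zero)

abbreviation "H \<equiv> htp.deriv"

text \<open>
  Both \<open>d h + h d\<close> and \<open>id - \<tau>\<close> satisfy the product rule \<open>T (u v) = T u (\<tau> v) + u (T v)\<close>, and they agree on
  letters.  For \<open>d h + h d\<close> this uses that \<open>\<tau>\<close> commutes with \<open>d\<close>, so that the mixed terms cancel.
\<close>

lemma word_homotopy:
  "is_word C G X Y w \<Longrightarrow>
    src.D (htp.word_der w) + H (word_dif C G w) = wd w - sub (letter_subst \<tau>) w"
proof (induction w arbitrary: Y)
  case (Cons l w)
  from Cons.prems obtain Z where l: "is_word C G Z Y [l]" and w: "is_word C G X Z w"
    by (subst (asm) is_word_Cons) auto
  let ?\<delta> = "letter_dif C G l" and ?h = "letter_htp \<kappa> l" and ?s = "sub (letter_subst \<tau>) w"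
    and ?n = "letter_deg G l"
  have wl: "wd [l] \<in> free_hom C G Z Y ?n" using l by simp
  have h: "?h \<in> free_hom C G Z Y (?n - 1)" using htp.letter_closed[OF l] by simp
  have k: "koszul (?n - 1) = - (koszul ?n :: 'k)" "koszul (?n + 1) = - (koszul ?n :: 'k)"
    using koszul_simps(1)[of "?n - 1" 1, where 'k = 'k] koszul_simps(1)[of ?n 1, where 'k = 'k] by simp_all
  have letter: "src.D ?h + H ?\<delta> = wd [l] - letter_subst \<tau> l"
    using l by (cases l) (auto simp: htp_gen)
  have eq1: "src.D (htp.word_der (l # w)) =
      wmul (src.D ?h) ?s - scal (koszul ?n) (wmul ?h (src.D ?s))
      + scal (koszul ?n) (wmul ?\<delta> (htp.word_der w)) + wmul (wd [l]) (src.D (htp.word_der w))"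
    by (simp add: word_dif_wmul[OF h] word_dif_wmul[OF wl] k lc.scale_right_distrib koszul_simps)
  have eq2: "H (word_dif C G (l # w)) =
      wmul (H ?\<delta>) ?s - scal (koszul ?n) (wmul ?\<delta> (htp.word_der w))
      + scal (koszul ?n) (wmul ?h (src.D ?s)) + wmul (wd [l]) (H (word_dif C G w))"
    by (simp add: der_wmul[OF src.letter_dif_free_hom[OF l]] der_wmul[OF wl] k
        lc.scale_right_distrib koszul_simps sub_word_dif[OF w])
  have "src.D (htp.word_der (l # w)) + H (word_dif C G (l # w)) =
      wmul (src.D ?h + H ?\<delta>) ?s + wmul (wd [l]) (src.D (htp.word_der w) + H (word_dif C G w))"
    unfolding eq1 eq2 by (simp add: algebra_simps)
  then show ?case unfolding letter Cons.IH[OF w] by simp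
qed simp

lemma homotopy:
  "p \<in> free_hom C G X Y n \<Longrightarrow> src.D (H p) + H (src.D p) = p - subst \<tau> p"
  by (erule lin_eqI_free_hom[rotated 2, where S = "\<lambda>p. src.D (H p) + H (src.D p)" and T = "\<lambda>p. p - subst \<tau> p"])
    (auto intro!: lin_intros linear_lin_extend word_homotopy)

lemma cocycle_homotopic:
  assumes p: "p \<in> free_hom C G X Y n" and "null C G X Y (n + 1) (src.D p)"
  shows "null C G X Y n (p - (subst \<tau> p + src.D (H p)))"
proof -
  have "p - (subst \<tau> p + src.D (H p)) = H (src.D p)" using homotopy[OF p] by (simp add: algebra_simps)
  then show ?thesis using htp.deriv_null[OF assms(2)] by simp
qed

end


section \<open>The differential of the refined generators\<close>

text \<open>
  The sum that defines the differential of the generator with indices \<open>is\<close>, for an arbitrary function \<open>f\<close> on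
  index lists in place of the generators; the freedom in \<open>f\<close> makes induction on the list possible.
\<close>

definition cech :: "(nat list \<Rightarrow> ('w \<Rightarrow>\<^sub>0 'k::field)) \<Rightarrow> nat list \<Rightarrow> ('w \<Rightarrow>\<^sub>0 'k)" where
  "cech f is = (\<Sum>t<length is. scal ((- 1) ^ (length is - Suc t)) (f (take t is @ drop (Suc t) is)))"

lemma cech_Nil [simp]: "cech f [] = 0"
  by (simp add: cech_def)

text \<open>
  The sign of a term counts the indices after the omitted one.  Hence omitting the last index carries the
  sign \<open>+\<close>, and appending an index changes all other signs.
\<close>

lemma cech_snoc [simp]: "cech f (is @ [i]) = f is - cech (\<lambda>js. f (js @ [i])) is"
proof -
  have "scal ((- 1) ^ (length is - t)) (f (take t (is @ [i]) @ drop (Suc t) (is @ [i])))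
      = - scal ((- 1) ^ (length is - Suc t)) (f ((take t is @ drop (Suc t) is) @ [i]))"
    if "t < length is" for t
    using that by (simp add: Suc_diff_Suc[symmetric])
  then show ?thesis by (simp add: cech_def sum_negf)
qed

lemma cech_singleton [simp]: "cech f [i] = f []"
  using cech_snoc[of f "[]" i] by simp

lemma cech_diff: "cech (\<lambda>js. f js - g js) is = cech f is - cech g is"
  by (simp add: cech_def lc.scale_right_diff_distrib sum_subtractf)

lemma cech_lin: "lin T \<Longrightarrow> T (cech f is) = cech (\<lambda>js. T (f js)) is"
  by (simp add: cech_def linD)

text \<open>
  Appending \<open>i\<close> produces the term \<open>cech f is\<close> twice, with opposite signs, and the iterated sum for the
  function \<open>\<lambda>js. f (js @ [i])\<close>, which vanishes by induction.
\<close>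

lemma cech_cech: "cech (cech f) is = 0"
proof (induction "is" arbitrary: f rule: rev_induct)
  case (snoc i "is")
  show ?case using snoc.IH[of "\<lambda>js. f (js @ [i])"] by (simp add: cech_diff snoc.IH)
qed simp

lemma cech_cong:
  "(\<And>t. t < length is \<Longrightarrow> f (take t is @ drop (Suc t) is) = g (take t is @ drop (Suc t) is)) \<Longrightarrow>
    cech f is = cech g is"
  by (simp add: cech_def)

text \<open>
  A function that depends on the length only and vanishes on lists of length at least two: on a pair the two
  terms cancel.  This is why killing all higher generators commutes with the differential.
\<close>

lemma cech_short:
  "cech (\<lambda>js. if js = [] then u else if length js = 1 then v else 0) is = (if length is = 1 then u else 0)"
proof -
  let ?f = "\<lambda>js :: nat list. if js = [] then u else if length js = 1 then v else 0"
  consider "is = []" | i where "is = [] @ [i]" | i j where "is = ([] @ [i]) @ [j]" | "length is \<ge> 3"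
  proof -
    assume *: "is = [] \<Longrightarrow> thesis" "\<And>i. is = [] @ [i] \<Longrightarrow> thesis"
      "\<And>i j. is = ([] @ [i]) @ [j] \<Longrightarrow> thesis" "3 \<le> length is \<Longrightarrow> thesis"
    show thesis
    proof (cases "length is \<ge> 3")
      case False
      then have "length is = 0 \<or> length is = Suc 0 \<or> length is = Suc (Suc 0)" by linarith
      then show thesis using * by (auto simp: length_Suc_conv)
    qed (rule *)
  qed
  then show ?thesis
  proof cases
    case 2
    then show ?thesis unfolding 2 cech_snoc by simp
  next
    case 3
    then show ?thesis unfolding 3 cech_snoc by simp
  next
    case 4
    then have "cech ?f is = cech (\<lambda>js. 0) is"
      by (intro cech_cong) (auto dest!: arg_cong[where f = length])
    also have "\<dots> = 0" by (simp add: cech_def)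
    finally show ?thesis using 4 by auto
  qed simp
qed

section \<open>The comparison of the two quotients\<close>

text \<open>
  The two quotients attached to sets of objects \<open>R 1, \<dots>, R k\<close>.  The generator with an empty index list is
  the empty word, so \<open>E X is\<close> makes sense for all index lists and the differential of \<open>E X is\<close> is always
  given by \<open>cech\<close>.
\<close>

locale cover = dg_category C
  for C :: "('o, 'm, 'k::field) dgcat" +
  fixes k :: nat and R :: "nat \<Rightarrow> 'o set"
begin

definition "Gref = refined_generators k (\<lambda>i. full_sub C (R i))"
definition "Gdri = drinfeld_generators (full_sub C (\<Union>i\<in>{1..k}. R i))"
abbreviation "E X is \<equiv> wd (eps_word X is) :: ('o, 'm, nat list, 'k) lincomb"

lemma generators_simps [simp]:
  "gens Gref X = {is. is \<noteq> [] \<and> sorted_wrt (<) is \<and> set is \<subseteq> {1..k} \<and> (\<forall>i\<in>set is. X \<in> R i)}"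
  "gdeg Gref is = - int (length is)"
  "gdif Gref X is = cech (E X) is"
  "gens Gdri X = (if X \<in> (\<Union>i\<in>{1..k}. R i) then {()} else {})"
  "gdeg Gdri u = - 1"
  "gdif Gdri X u = wd []"
  by (simp_all add: Gref_def Gdri_def refined_generators_def drinfeld_generators_def full_sub_def cech_def)

lemma eps_word_simps [simp]: "eps_word X [] = []" "is \<noteq> [] \<Longrightarrow> eps_word X is = [Eps X is]"
  by (simp_all add: eps_word_def)

lemma word_dif_eps_word: "word_dif C Gref (eps_word X is) = cech (E X) is"
  by (cases "is = []") simp_all

lemma generated_extension_refined: "generated_extension C Gref"
proof
  fix X "is" assume X: "X \<in> Obj C" and "is": "is \<in> gens Gref X"
  have "E X (take t is @ drop (Suc t) is) \<in> free_hom C Gref X X (gdeg Gref is + 1)"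
    if t: "t < length is" for t
  proof -
    let ?js = "take t is @ drop (Suc t) is"
    have "sorted_wrt (<) ?js"
      using "is" t by (auto simp: sorted_wrt_iff_nth_less nth_append)
    moreover have "set ?js \<subseteq> set is" using set_take_subset set_drop_subset by fastforce
    moreover have "length ?js + 1 = length is" using t by simp
    ultimately show ?thesis
      using X "is" by (cases "?js = []") (auto simp del: take_append drop_append append_is_Nil_conv length_append set_append)
  qed
  then show "gdif Gref X is \<in> free_hom C Gref X X (gdeg Gref is + 1)"
    unfolding generators_simps(3) cech_def by (intro free_hom_sum free_hom_scal) auto
  have "lin_extend (word_dif C Gref) (gdif Gref X is) = cech (cech (E X)) is"
    by (simp add: cech_lin[OF linear_lin_extend] word_dif_eps_word)
  then show "null C Gref X X (gdeg Gref is + 1 + 1) (lin_extend (word_dif C Gref) (gdif Gref X is))"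
    using X by (simp add: cech_cech null_zero)
qed

lemma generated_extension_drinfeld: "generated_extension C Gdri"
  by standard (auto intro: null_zero)

lemma refined_generator_index:
  assumes "is \<in> gens Gref X"
  obtains i where "i \<in> {1..k}" "X \<in> R i"
  using assms by (cases "is") auto

text \<open>
  The vertex from which the simplex of indices at \<open>X\<close> is coned off.  It is the largest one, so that
  appending it to an increasing list leaves the list increasing and no sign for reordering is needed.
\<close>

definition top_index :: "'o \<Rightarrow> nat" where
  "top_index X = Max {i \<in> {1..k}. X \<in> R i}"

lemma top_index:
  assumes "i \<in> {1..k}" "X \<in> R i"
  shows "top_index X \<in> {1..k}" "X \<in> R (top_index X)" "i \<le> top_index X"
proof -
  have "top_index X \<in> {i \<in> {1..k}. X \<in> R i}"
    unfolding top_index_def using assms by (intro Max_in) auto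
  then show "top_index X \<in> {1..k}" "X \<in> R (top_index X)" by auto
  show "i \<le> top_index X" unfolding top_index_def using assms by (intro Max_ge) auto
qed

text \<open>
  \<open>collapse\<close> is the substitution that gives \<open>\<Psi>\<close>, \<open>lift\<close> gives its section, \<open>collapse_lift\<close> is
  the composite of \<open>collapse\<close> followed by \<open>lift\<close>, and \<open>cone\<close> is the homotopy from it to the identity.
\<close>

definition collapse :: "'o \<Rightarrow> nat list \<Rightarrow> ('o, 'm, unit, 'k) lincomb" where
  "collapse X is = (if length is = 1 then wd [Eps X ()] else 0)"

definition lift :: "'o \<Rightarrow> unit \<Rightarrow> ('o, 'm, nat list, 'k) lincomb" where
  "lift X u = wd [Eps X [top_index X]]"

definition collapse_lift :: "'o \<Rightarrow> nat list \<Rightarrow> ('o, 'm, nat list, 'k) lincomb" where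
  "collapse_lift X is = (if length is = 1 then wd [Eps X [top_index X]] else 0)"

definition cone :: "'o \<Rightarrow> nat list \<Rightarrow> ('o, 'm, nat list, 'k) lincomb" where
  "cone X is = (if top_index X \<in> set is then 0 else wd [Eps X (is @ [top_index X])])"

lemma word_dif_single [simp]:
  "word_dif C Gref [Eps X [i]] = wd []" "word_dif C Gdri [Eps X u] = wd []"
  by simp_all

lemma subst_eps_word:
  "subst \<rho> (E X is) = (if is = [] then wd [] else \<rho> X is)"
  by (cases "is = []") simp_all

lemma dg_substitution_collapse: "dg_substitution C Gref Gdri collapse"
proof (intro dg_substitution.intro generated_extension_refined generated_extension_drinfeld
    substitution.intro substitution_axioms.intro dg_substitution_axioms.intro)
  show "dg_category C" by (rule dg_category_axioms)
  fix X "is" assume X: "X \<in> Obj C" and "is": "is \<in> gens Gref X"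
  obtain i where "i \<in> {1..k}" "X \<in> R i" by (rule refined_generator_index[OF "is"])
  then show "collapse X is \<in> free_hom C Gdri X X (gdeg Gref is)"
    using X by (auto simp: collapse_def)
  have "subst collapse (gdif Gref X is) =
      cech (\<lambda>js. if js = [] then wd [] else if length js = 1 then wd [Eps X ()] else 0) is"
    unfolding generators_simps(3) cech_lin[OF linear_lin_extend] subst_eps_word
    unfolding collapse_def ..
  then show "subst collapse (gdif Gref X is) = lin_extend (word_dif C Gdri) (collapse X is)"
    unfolding cech_short by (simp add: collapse_def)
qed

lemma dg_substitution_lift: "dg_substitution C Gdri Gref lift"
proof (intro dg_substitution.intro generated_extension_refined generated_extension_drinfeld
    substitution.intro substitution_axioms.intro dg_substitution_axioms.intro)
  show "dg_category C" by (rule dg_category_axioms)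
  fix X and u :: unit assume X: "X \<in> Obj C" and "u \<in> gens Gdri X"
  then obtain i where "i \<in> {1..k}" "X \<in> R i" by (auto split: if_splits)
  then show "lift X u \<in> free_hom C Gref X X (gdeg Gdri u)"
    using top_index[of i X] X by (auto simp: lift_def)
qed (simp add: lift_def)

lemma dg_substitution_collapse_lift: "dg_substitution C Gref Gref collapse_lift"
proof (intro dg_substitution.intro generated_extension_refined
    substitution.intro substitution_axioms.intro dg_substitution_axioms.intro)
  show "dg_category C" by (rule dg_category_axioms)
  fix X "is" assume X: "X \<in> Obj C" and "is": "is \<in> gens Gref X"
  obtain i where "i \<in> {1..k}" "X \<in> R i" by (rule refined_generator_index[OF "is"])
  then show "collapse_lift X is \<in> free_hom C Gref X X (gdeg Gref is)"
    using X top_index[of i X] by (auto simp: collapse_lift_def)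
  have "subst collapse_lift (gdif Gref X is) =
      cech (\<lambda>js. if js = [] then wd [] else if length js = 1 then wd [Eps X [top_index X]] else 0) is"
    unfolding generators_simps(3) cech_lin[OF linear_lin_extend] subst_eps_word
    unfolding collapse_lift_def ..
  then show "subst collapse_lift (gdif Gref X is) = lin_extend (word_dif C Gref) (collapse_lift X is)"
    unfolding cech_short by (simp add: collapse_lift_def)
qed

text \<open>
  The contraction of the augmented simplex by coning off with the vertex \<open>a\<close>.  The homotopy sends the identity to
  \<open>0\<close> instead of \<open>\<epsilon>\<^sup>a\<close>; this affects only lists of length one, whose differential is the identity, and
  accounts for the term \<open>collapse_lift\<close>.
\<close>

lemma subst_homotopy_cone: "subst_homotopy C Gref collapse_lift cone"
proof (intro subst_homotopy.intro dg_substitution_collapse_lift subst_homotopy_axioms.intro)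
  fix X "is" assume X: "X \<in> Obj C" and "is": "is \<in> gens Gref X"
  define a where "a = top_index X"
  have i: "i \<in> {1..k}" "X \<in> R i" "i \<le> a" if "i \<in> set is" for i
    using "is" that top_index(3)[of i X] by (auto simp: a_def)
  have a: "a \<in> {1..k}" "X \<in> R a"
    using refined_generator_index[OF "is"] top_index(1,2) unfolding a_def by metis+
  show "cone X is \<in> free_hom C Gref X X (gdeg Gref is - 1)"
    using X "is" i a by (auto simp: cone_def sorted_wrt_append a_def[symmetric] order_less_le)
  let ?h = "der (letter_deg Gref) (letter_subst collapse_lift) (letter_htp cone)"
  have h: "lin_extend ?h (E X js) = (if js = [] \<or> a \<in> set js then 0 else E X (js @ [a]))" for js
    by (cases "js = []") (simp_all add: cone_def a_def)
  have hd: "lin_extend ?h (gdif Gref X is) =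
      cech (\<lambda>js. if js = [] \<or> a \<in> set js then 0 else E X (js @ [a])) is"
    unfolding generators_simps(3) cech_lin[OF linear_lin_extend] h ..
  show "lin_extend (word_dif C Gref) (cone X is) + lin_extend ?h (gdif Gref X is)
      = wd [Eps X is] - collapse_lift X is"
  proof (cases "a \<in> set is")
    case True
    \<comment> \<open>All terms but the one omitting the last index \<open>a\<close> still contain \<open>a\<close>, so \<open>cone\<close> maps them to \<open>0\<close>.\<close>
    obtain js b where js: "is = js @ [b]" using "is" by (cases "is" rule: rev_cases) auto
    have "b = a" using True "is" i[of b] by (fastforce simp: js sorted_wrt_append)
    moreover have "a \<notin> set js" using "is" \<open>b = a\<close> by (auto simp: js sorted_wrt_append)
    moreover have "cech (\<lambda>js. 0) js = (0 :: ('o, 'm, nat list, 'k) lincomb)" by (simp add: cech_def)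
    ultimately have eq: "lin_extend ?h (gdif Gref X is) = (if js = [] then 0 else E X is)"
      unfolding hd unfolding js by simp
    have cone: "cone X is = 0" using True by (simp add: cone_def a_def)
    show ?thesis unfolding eq cone using \<open>b = a\<close>
      by (cases "js = []") (simp_all add: js collapse_lift_def a_def)
  next
    case False
    \<comment> \<open>The last term of the differential of the cone omits \<open>a\<close> and is the generator itself; the others form
      minus the cone over its boundary.\<close>
    have "lin_extend (word_dif C Gref) (cone X is) = cech (E X) (is @ [a])"
      using False word_dif_eps_word[of X "is @ [a]"] by (simp add: cone_def a_def del: cech_snoc)
    then have D: "lin_extend (word_dif C Gref) (cone X is) = wd [Eps X is] - cech (\<lambda>js. E X (js @ [a])) is"
      using "is" by simp
    show ?thesis
    proof (cases "length is = 1")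
      case True
      then obtain b where b: "is = [] @ [b]" by (auto simp: length_Suc_conv)
      show ?thesis unfolding D hd unfolding b cech_snoc
        by (simp add: collapse_lift_def a_def)
    next
      case ne: False
      have "cech (\<lambda>js. if js = [] \<or> a \<in> set js then 0 else E X (js @ [a])) is
          = cech (\<lambda>js. E X (js @ [a])) is"
      proof (rule cech_cong)
        fix t assume t: "t < length is"
        let ?js = "take t is @ drop (Suc t) is"
        have "length ?js \<noteq> 0" using t ne by simp
        then have "?js \<noteq> []" by (metis list.size(3))
        moreover have "a \<notin> set ?js" using False by (auto dest: in_set_takeD in_set_dropD)
        ultimately have "\<not> (?js = [] \<or> a \<in> set ?js)" by blast
        then show "(if ?js = [] \<or> a \<in> set ?js then 0 else E X (?js @ [a])) = E X (?js @ [a])"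
          by (rule if_not_P)
      qed
      then show ?thesis unfolding D hd using ne by (simp add: collapse_lift_def)
    qed
  qed
qed

sublocale refined: generated_extension C Gref by (rule generated_extension_refined)
sublocale drinfeld: generated_extension C Gdri by (rule generated_extension_drinfeld)
sublocale collapse: dg_substitution C Gref Gdri collapse by (rule dg_substitution_collapse)
sublocale lift: dg_substitution C Gdri Gref lift by (rule dg_substitution_lift)
sublocale cone: subst_homotopy C Gref collapse_lift cone by (rule subst_homotopy_cone)

lemma collapse_after_lift: "subst collapse (subst lift p) = p"
  using subst_Eps[of p] by (simp add: subst_subst lift_def collapse_def)

lemma lift_after_collapse: "subst lift (subst collapse p) = subst collapse_lift p"
proof -
  have "(\<lambda>X is. subst lift (collapse X is)) = collapse_lift"
    by (auto simp: fun_eq_iff collapse_def collapse_lift_def lift_def)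
  then show ?thesis by (simp add: subst_subst)
qed

lemma natural_collapse:
  "natural_quotient_functor C k (\<lambda>i. full_sub C (R i)) (full_sub C (\<Union>i\<in>{1..k}. R i)) collapse.subst_functor"
proof -
  have eps: "fmor collapse.subst_functor X X (gdeg Gref is) (adjoin_eps C Gref X is)
      = residue C Gdri X X (gdeg Gref is) (collapse X is)"
    if "X \<in> Obj C" "is \<in> gens Gref X" for X "is"
    using collapse.subst_functor_residue[of X X "wd [Eps X is]" "gdeg Gref is"] that
    by (simp add: adjoin_eps_def)
  show ?thesis
    unfolding natural_quotient_functor_def refined_drinfeld_quotient_def drinfeld_quotient_def
      Gref_def[symmetric] Gdri_def[symmetric]
  proof (intro conjI ballI allI impI)
    show "dg_functor (adjoin C Gref) (adjoin C Gdri) collapse.subst_functor"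
      by (rule collapse.dg_functor_subst)
    show "fobj collapse.subst_functor X = X" for X by (simp add: collapse.subst_functor_def)
    show "fmor collapse.subst_functor X Y n (adjoin_mor C Gref X Y n f) = adjoin_mor C Gdri X Y n f"
      if "X \<in> Obj C" "Y \<in> Obj C" "f \<in> carrier (Hom C X Y n)" for X Y n f
      using collapse.subst_functor_residue[of X Y "wd [Mor X Y n f]" n] that
      by (simp add: adjoin_mor_def)
    show "fmor collapse.subst_functor X X (- 1) (adjoin_eps C Gref X [i]) = adjoin_eps C Gdri X ()"
      if "X \<in> Obj C" "[i] \<in> gens Gref X" for X i
      using eps[OF that] by (simp add: collapse_def adjoin_eps_def)
    show "fmor collapse.subst_functor X X (- int (length is)) (adjoin_eps C Gref X is)
        = \<zero>\<^bsub>Hom (adjoin C Gdri) X X (- int (length is))\<^esub>"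
      if "X \<in> Obj C" "is \<in> gens Gref X" "length is > 1" for X "is"
      using eps[OF that(1,2)] that(3) by (simp add: collapse_def)
  qed
qed

lemma natural_functor_unique:
  assumes "natural_quotient_functor C k (\<lambda>i. full_sub C (R i)) (full_sub C (\<Union>i\<in>{1..k}. R i)) \<Psi>"
    and "X \<in> Obj C" "Y \<in> Obj C" "p \<in> free_hom C Gref X Y n"
  shows "fmor \<Psi> X Y n (residue C Gref X Y n p) = residue C Gdri X Y n (subst collapse p)"
proof -
  note unfold = natural_quotient_functor_def refined_drinfeld_quotient_def drinfeld_quotient_def
    Gref_def[symmetric] Gdri_def[symmetric]
  note \<Psi> = assms(1)[unfolded unfold] and \<Phi> = natural_collapse[unfolded unfold]
  have "fmor \<Psi> X Y n (residue C Gref X Y n p) = fmor collapse.subst_functor X Y n (residue C Gref X Y n p)"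
  proof (rule refined.functors_agree[OF _ collapse.dg_functor_subst])
    show "dg_functor (adjoin C Gref) (adjoin C Gdri) \<Psi>" using \<Psi> by blast
    show "fobj \<Psi> X = fobj collapse.subst_functor X" if "X \<in> Obj C" for X
      using \<Psi> \<Phi> that by simp
    show "fmor \<Psi> X Y n (adjoin_mor C Gref X Y n f) = fmor collapse.subst_functor X Y n (adjoin_mor C Gref X Y n f)"
      if "X \<in> Obj C" "Y \<in> Obj C" "f \<in> carrier (Hom C X Y n)" for X Y n f
      using \<Psi> \<Phi> that by simp
    show "fmor \<Psi> X X (gdeg Gref is) (adjoin_eps C Gref X is) =
        fmor collapse.subst_functor X X (gdeg Gref is) (adjoin_eps C Gref X is)"
      if X: "X \<in> Obj C" and "is": "is \<in> gens Gref X" for X "is"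
    proof (cases "length is > 1")
      case True
      then show ?thesis using \<Psi> \<Phi> X "is" unfolding generators_simps(2) by metis
    next
      case False
      then have "length is = Suc 0" using "is" by (cases "is") auto
      then obtain i where "is = [i]" by (auto simp: length_Suc_conv)
      then show ?thesis using \<Psi> \<Phi> X "is" by (simp del: generators_simps(1))
    qed
  qed (use assms in auto)
  then show ?thesis using collapse.subst_functor_residue assms by simp
qed

lemma mem_cocycles_residue:
  assumes "generated_extension C G" "X \<in> Obj C" "Y \<in> Obj C" "p \<in> free_hom C G X Y n"
  shows "residue C G X Y n p \<in> cocycles (adjoin C G) X Y n \<longleftrightarrow>
    null C G X Y (n + 1) (lin_extend (word_dif C G) p)"
proof -
  interpret G: generated_extension C G by (rule assms)
  show ?thesis
    using assms G.dif_residue[OF assms(2-4)] residue_zero_iff[OF assms(2,3) G.dif_free_hom[OF assms(4)]]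
    by (simp add: cocycles_def)
qed

lemma quasi_equivalence_natural:
  assumes \<Psi>: "natural_quotient_functor C k (\<lambda>i. full_sub C (R i)) (full_sub C (\<Union>i\<in>{1..k}. R i)) \<Psi>"
  shows "quasi_equivalence (adjoin C Gref) (adjoin C Gdri) \<Psi>"
proof -
  interpret F: dg_functor "adjoin C Gref" "adjoin C Gdri" \<Psi>
    using \<Psi> by (simp add: natural_quotient_functor_def refined_drinfeld_quotient_def
        drinfeld_quotient_def Gref_def Gdri_def)
  have obj: "fobj \<Psi> X = X" if "X \<in> Obj C" for X
    using \<Psi> that by (simp add: natural_quotient_functor_def)
  note mor = natural_functor_unique[OF \<Psi>]
  show ?thesis
  proof (rule F.quasi_equivalenceI)
    show "fobj \<Psi> ` Obj (adjoin C Gref) = Obj (adjoin C Gdri)" by (simp add: obj)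
  next
    fix X Y n Q
    assume "X \<in> Obj (adjoin C Gref)" "Y \<in> Obj (adjoin C Gref)"
      and Q: "Q \<in> cocycles (adjoin C Gdri) (fobj \<Psi> X) (fobj \<Psi> Y) n"
    then have o: "X \<in> Obj C" "Y \<in> Obj C" by auto
    obtain q where q: "q \<in> free_hom C Gdri X Y n" "Q = residue C Gdri X Y n q"
      using Q o by (auto simp: cocycles_def obj)
    have "null C Gdri X Y (n + 1) (drinfeld.D q)"
      using Q mem_cocycles_residue[OF generated_extension_drinfeld o q(1)] by (simp add: q obj o)
    from lift.subst_null[OF this] have "null C Gref X Y (n + 1) (refined.D (subst lift q))"
      by (simp add: lift.subst_dif[OF q(1)])
    then have "residue C Gref X Y n (subst lift q) \<in> cocycles (adjoin C Gref) X Y n"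
      using mem_cocycles_residue[OF generated_extension_refined o lift.subst_free_hom[OF q(1)]] by simp
    moreover have "fmor \<Psi> X Y n (residue C Gref X Y n (subst lift q)) = Q"
      by (simp add: mor o lift.subst_free_hom q collapse_after_lift)
    ultimately show "\<exists>P\<in>cocycles (adjoin C Gref) X Y n. fmor \<Psi> X Y n P = Q" by blast
  next
    fix X Y n P
    assume "X \<in> Obj (adjoin C Gref)" "Y \<in> Obj (adjoin C Gref)"
      and P: "P \<in> cocycles (adjoin C Gref) X Y n"
      and bd: "fmor \<Psi> X Y n P \<in> coboundaries (adjoin C Gdri) (fobj \<Psi> X) (fobj \<Psi> Y) n"
    then have o: "X \<in> Obj C" "Y \<in> Obj C" by auto
    obtain p where p: "p \<in> free_hom C Gref X Y n" "P = residue C Gref X Y n p"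
      using P by (auto simp: cocycles_def)
    have Dp: "null C Gref X Y (n + 1) (refined.D p)"
      using P mem_cocycles_residue[OF generated_extension_refined o p(1)] by (simp add: p)
    obtain q where q: "q \<in> free_hom C Gdri X Y (n - 1)"
      and "fmor \<Psi> X Y n P = dif (adjoin C Gdri) X Y (n - 1) (residue C Gdri X Y (n - 1) q)"
      using bd by (auto simp: coboundaries_def obj o simp del: adjoin_simps(3))
    then have "residue C Gdri X Y n (subst collapse p) = residue C Gdri X Y n (drinfeld.D q)"
      using mor[OF o p(1)] drinfeld.dif_residue[OF o q] by (simp add: p)
    moreover have Dq: "drinfeld.D q \<in> free_hom C Gdri X Y n" using drinfeld.dif_free_hom[OF q] by simp
    ultimately have "null C Gdri X Y n (subst collapse p - drinfeld.D q)"
      using residue_eq_iff[OF o collapse.subst_free_hom[OF p(1)] Dq] by simp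
    from lift.subst_null[OF this]
    have "null C Gref X Y n (subst collapse_lift p - refined.D (subst lift q))"
      by (simp add: lift_after_collapse lift.subst_dif[OF q])
    \<comment> \<open>Now \<open>p\<close> is \<open>collapse_lift p + d (h p)\<close> and \<open>collapse_lift p\<close> is \<open>d (lift q)\<close>, modulo relations.\<close>
    from null_add[OF cone.cocycle_homotopic[OF p(1) Dp] this]
    have "null C Gref X Y n (p - refined.D (subst lift q + cone.H p))"
      by (simp add: algebra_simps)
    moreover have r: "subst lift q + cone.H p \<in> free_hom C Gref X Y (n - 1)"
      using lift.subst_free_hom[OF q] cone.htp.deriv_free_hom[OF p(1)] by auto
    moreover have "refined.D (subst lift q + cone.H p) \<in> free_hom C Gref X Y n"
      using refined.dif_free_hom[OF r] by simp
    ultimately have "P = residue C Gref X Y n (refined.D (subst lift q + cone.H p))"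
      unfolding p(2) by (intro residue_eqI p(1))
    also have "\<dots> = dif (adjoin C Gref) X Y (n - 1) (residue C Gref X Y (n - 1) (subst lift q + cone.H p))"
      using refined.dif_residue[OF o r] by simp
    finally show "P \<in> coboundaries (adjoin C Gref) X Y n"
      using r by (auto simp: coboundaries_def simp del: adjoin_simps(3))
  qed
qed

end

theorem lemma4p3:
  fixes C :: "('o, 'm, 'k::field_char_0) dgcat"
    and k :: nat
    and S R :: "nat \<Rightarrow> 'o set"
  assumes "dg_category C"
    and "\<And>i. i \<in> {1..k} \<Longrightarrow> S i \<subseteq> Obj C"
    and "compatible_representatives C k S R"
  shows "(\<exists>\<Psi>. natural_quotient_functor C k (\<lambda>i. full_sub C (R i)) (full_sub C (\<Union>i\<in>{1..k}. R i)) \<Psi>) \<and>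
    (\<forall>\<Psi>. natural_quotient_functor C k (\<lambda>i. full_sub C (R i)) (full_sub C (\<Union>i\<in>{1..k}. R i)) \<Psi> \<longrightarrow>
      quasi_equivalence
        (refined_drinfeld_quotient C k (\<lambda>i. full_sub C (R i)))
        (drinfeld_quotient C (full_sub C (\<Union>i\<in>{1..k}. R i))) \<Psi>)"
proof -
  interpret cover C k R by (rule cover.intro[OF assms(1)])
  show ?thesis
    using natural_collapse quasi_equivalence_natural
    unfolding refined_drinfeld_quotient_def drinfeld_quotient_def Gref_def Gdri_def by blast
qed

end
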